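(* Let $E_1,\dots,E_m$ and $F$ be Banach spaces. If $F$ is reflexive, then $\mathcal{L}_{DP}^{\mathrm{ev}}(E_1,\dots,E_m;F)=\mathcal{L}_{WDP}^{\mathrm{ev}}(E_1,\dots,E_m;F)$.
   Context: Banach spaces are over $\mathbb{K}=\mathbb{R}$ or $\mathbb{C}$; $F'$ is the topological dual of $F$; $\overset{w}{\to}$ denotes weak convergence of sequences (in $F'$ this means $\sigma(F',F'')$); $\mathcal{L}(E_1,\dots,E_m;F)$ is the space of continuous $m$-linear operators. $T\in\mathcal{L}_{DP}^{\mathrm{ev}}(E_1,\dots,E_m;F)$ if for all $(a_1,\dots,a_m)\in E_1\times\cdots\times E_m$ and all sequences $x_j^{(i)}\overset{w}{\to}a_i$ in $E_i$ ($i=1,\dots,m$), $T(x_j^{(1)},\dots,x_j^{(m)})\to T(a_1,\dots,a_m)$ in norm. $T\in\mathcal{L}_{WDP}^{\mathrm{ev}}(E_1,\dots,E_m;F)$ if for all $(a_1,\dots,a_m)$, all sequences $x_j^{(i)}\overset{w}{\to}a_i$ in $E_i$ ($i=1,\dots,m$), and all sequences $f_j\overset{w}{\to}f$ in $F'$ with $f\in F'$, one has $f_j(T(x_j^{(1)},\dots,x_j^{(m)}))\to f(T(a_1,\dots,a_m))$. *)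

theory Defs
  imports "HOL-Analysis.Analysis" "HOL-Algebra.Module"
begin

text \<open>
  A type of this class is, as a normed field, either the real or the complex numbers: the norm
  of \<^class>\<open>real_normed_field\<close> is multiplicative and extends the absolute value of the reals,
  which determines it in both cases.
\<close>
class real_or_complex = real_normed_field +
  assumes real_or_complex:
    "(\<forall>z. \<exists>a. z = a *\<^sub>R 1) \<or>
     (\<exists>i. i * i = - 1 \<and> (\<forall>z. \<exists>a b. z = a *\<^sub>R 1 + b *\<^sub>R i))"

instance real :: real_or_complex
  by standard simp

instance complex :: real_or_complex
proof
  have "z = Re z *\<^sub>R 1 + Im z *\<^sub>R \<i>" for z
    by (simp add: complex_eq_iff)
  then have "\<forall>z. \<exists>a b. z = a *\<^sub>R 1 + b *\<^sub>R \<i>"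
    by blast
  then show "(\<forall>z::complex. \<exists>a. z = a *\<^sub>R 1) \<or>
      (\<exists>i::complex. i * i = - 1 \<and> (\<forall>z. \<exists>a b. z = a *\<^sub>R 1 + b *\<^sub>R i))"
    by (intro disjI2 exI[of _ \<i>] conjI) simp_all
qed

text \<open>
  Spaces have explicit carriers, so that the members of a finite family of spaces, indexed by
  numbers, may differ from each other although their elements share a type. As always in
  \<^theory>\<open>HOL-Algebra.Module\<close>, the fields \<^term>\<open>mult\<close> and \<^term>\<open>one\<close> of a
  module play no role.
\<close>
record ('k, 'a) normed_space = "('k, 'a) module" +
  nrm :: "'a \<Rightarrow> real"

text \<open>The scalar field, both as a ring and as a normed space over itself.\<close>
definition scalars :: "('k::real_or_complex, 'k) normed_space" where
  "scalars = \<lparr>carrier = UNIV, mult = (*), one = 1, zero = 0, add = (+), smult = (*), nrm = norm\<rparr>"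

definition is_normed_space :: "('k::real_or_complex, 'a) normed_space \<Rightarrow> bool" where
  "is_normed_space X \<longleftrightarrow>
     Module.module scalars X \<and>
     (\<forall>x\<in>carrier X. 0 \<le> nrm X x \<and> (nrm X x = 0 \<longleftrightarrow> x = \<zero>\<^bsub>X\<^esub>)) \<and>
     (\<forall>c. \<forall>x\<in>carrier X. nrm X (c \<odot>\<^bsub>X\<^esub> x) = norm c * nrm X x) \<and>
     (\<forall>x\<in>carrier X. \<forall>y\<in>carrier X. nrm X (x \<oplus>\<^bsub>X\<^esub> y) \<le> nrm X x + nrm X y)"

text \<open>
  The locale \<^locale>\<open>Metric_space\<close> requires a symmetric and nonnegative distance also outside
  the carrier, hence the default value.
\<close>
definition ndist :: "('k, 'a) normed_space \<Rightarrow> 'a \<Rightarrow> 'a \<Rightarrow> real" where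
  "ndist X x y = (if x \<in> carrier X \<and> y \<in> carrier X then nrm X (x \<ominus>\<^bsub>X\<^esub> y) else 0)"

definition norm_topology :: "('k, 'a) normed_space \<Rightarrow> 'a topology" where
  "norm_topology X = Metric_space.mtopology (carrier X) (ndist X)"

definition is_banach_space :: "('k::real_or_complex, 'a) normed_space \<Rightarrow> bool" where
  "is_banach_space X \<longleftrightarrow>
     is_normed_space X \<and> Metric_space.mcomplete (carrier X) (ndist X)"

definition is_linear ::
  "('k::real_or_complex, 'a) normed_space \<Rightarrow> ('k, 'b) normed_space \<Rightarrow> ('a \<Rightarrow> 'b) \<Rightarrow> bool" where
  "is_linear X Y h \<longleftrightarrow>
     h \<in> carrier X \<rightarrow> carrier Y \<and>
     (\<forall>x\<in>carrier X. \<forall>y\<in>carrier X. h (x \<oplus>\<^bsub>X\<^esub> y) = h x \<oplus>\<^bsub>Y\<^esub> h y) \<and>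
     (\<forall>c. \<forall>x\<in>carrier X. h (c \<odot>\<^bsub>X\<^esub> x) = c \<odot>\<^bsub>Y\<^esub> h x)"

text \<open>
  Functionals on \<open>X\<close> are functions that are \<^term>\<open>undefined\<close> outside \<^term>\<open>carrier X\<close>,
  so that equality of functionals is equality of functions.
\<close>
definition dual :: "('k::real_or_complex, 'a) normed_space \<Rightarrow> ('k, 'a \<Rightarrow> 'k) normed_space" where
  "dual X =
    \<lparr>carrier = {f \<in> extensional (carrier X). is_linear X scalars f \<and>
                  continuous_map (norm_topology X) (norm_topology scalars) f},
     mult = undefined, one = undefined,
     zero = (\<lambda>x\<in>carrier X. 0),
     add = (\<lambda>f g. \<lambda>x\<in>carrier X. f x + g x),
     smult = (\<lambda>c f. \<lambda>x\<in>carrier X. c * f x),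
     nrm = (\<lambda>f. SUP x\<in>{x \<in> carrier X. nrm X x \<le> 1}. norm (f x))\<rparr>"

definition canonical_embedding ::
  "('k::real_or_complex, 'a) normed_space \<Rightarrow> 'a \<Rightarrow> ('a \<Rightarrow> 'k) \<Rightarrow> 'k" where
  "canonical_embedding X x = (\<lambda>f\<in>carrier (dual X). f x)"

definition reflexive_space :: "('k::real_or_complex, 'a) normed_space \<Rightarrow> bool" where
  "reflexive_space X \<longleftrightarrow> canonical_embedding X ` carrier X = carrier (dual (dual X))"

definition weakly_converges ::
  "('k::real_or_complex, 'a) normed_space \<Rightarrow> (nat \<Rightarrow> 'a) \<Rightarrow> 'a \<Rightarrow> bool" where
  "weakly_converges X x a \<longleftrightarrow>
     (\<forall>j. x j \<in> carrier X) \<and> a \<in> carrier X \<and>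
     (\<forall>f\<in>carrier (dual X). (\<lambda>j. f (x j)) \<longlonglongrightarrow> f a)"

abbreviation tuples :: "nat \<Rightarrow> (nat \<Rightarrow> ('k, 'a) normed_space) \<Rightarrow> (nat \<Rightarrow> 'a) set" where
  "tuples m E \<equiv> \<Pi>\<^sub>E i\<in>{1..m}. carrier (E i)"

text \<open>The continuous \<open>m\<close>-linear operators; again, \<open>extensional\<close> makes equality of operators
  equality of functions.\<close>
definition multilinear_ops ::
  "nat \<Rightarrow> (nat \<Rightarrow> ('k::real_or_complex, 'a) normed_space) \<Rightarrow> ('k, 'b) normed_space \<Rightarrow>
    ((nat \<Rightarrow> 'a) \<Rightarrow> 'b) set" where
  "multilinear_ops m E F =
    {T \<in> extensional (tuples m E).
       (\<forall>x\<in>tuples m E. \<forall>i\<in>{1..m}. is_linear (E i) F (\<lambda>u. T (x(i := u)))) \<and>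
       continuous_map (product_topology (\<lambda>i. norm_topology (E i)) {1..m}) (norm_topology F) T}"

text \<open>Below, \<open>x i j\<close> is the \<open>j\<close>-th term of the sequence in \<open>E i\<close>.\<close>
definition L_DP_ev ::
  "nat \<Rightarrow> (nat \<Rightarrow> ('k::real_or_complex, 'a) normed_space) \<Rightarrow> ('k, 'b) normed_space \<Rightarrow>
    ((nat \<Rightarrow> 'a) \<Rightarrow> 'b) set" where
  "L_DP_ev m E F =
    {T \<in> multilinear_ops m E F.
       \<forall>a\<in>tuples m E. \<forall>x :: nat \<Rightarrow> nat \<Rightarrow> 'a.
         (\<forall>i\<in>{1..m}. weakly_converges (E i) (x i) (a i)) \<longrightarrow>
         limitin (norm_topology F) (\<lambda>j. T (\<lambda>i\<in>{1..m}. x i j)) (T a) sequentially}"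

definition L_WDP_ev ::
  "nat \<Rightarrow> (nat \<Rightarrow> ('k::real_or_complex, 'a) normed_space) \<Rightarrow> ('k, 'b) normed_space \<Rightarrow>
    ((nat \<Rightarrow> 'a) \<Rightarrow> 'b) set" where
  "L_WDP_ev m E F =
    {T \<in> multilinear_ops m E F.
       \<forall>a\<in>tuples m E. \<forall>(x :: nat \<Rightarrow> nat \<Rightarrow> 'a) (g :: nat \<Rightarrow> 'b \<Rightarrow> 'k) f.
         (\<forall>i\<in>{1..m}. weakly_converges (E i) (x i) (a i)) \<and> weakly_converges (dual F) g f \<longrightarrow>
         (\<lambda>j. g j (T (\<lambda>i\<in>{1..m}. x i j))) \<longlonglongrightarrow> f (T a)}"

end

theory Submission
  imports Defs "HOL-Complex_Analysis.Great_Picard"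
begin

text \<open>
  If \<open>y\<^sub>j \<longlonglongrightarrow> y\<close> in norm and \<open>f\<^sub>j \<longlonglongrightarrow> f\<close> weakly, then the \<open>f\<^sub>j\<close> are bounded by the uniform
  boundedness principle, so \<open>f\<^sub>j y\<^sub>j \<longlonglongrightarrow> f y\<close>. Conversely,
  if \<open>T (x\<^sub>j)\<close> stays away from \<open>T a\<close> along a subsequence, choose by Hahn-Banach functionals \<open>f\<^sub>j\<close> in
  the unit ball of \<open>F'\<close> that are bounded away from zero at \<open>T (x\<^sub>j) - T a\<close>. As \<open>F\<close> is reflexive, a
  subsequence of the \<open>f\<^sub>j\<close> converges weakly, and then \<open>f\<^sub>j (T (x\<^sub>j))\<close> and \<open>f\<^sub>j (T a)\<close> have the same
  limit, a contradiction.

  The weakly convergent subsequence is found as follows. A countable set \<open>D\<close> is dense in the closed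
  span of the \<open>f\<^sub>j\<close>; a diagonal subsequence converges on a countable set \<open>S \<subseteq> F\<close> that norms \<open>D\<close>. The
  oscillation \<open>q x = lim\<^sub>n sup {\<bar>f\<^sub>k x - f\<^sub>l x\<bar> | k, l \<ge> n}\<close> is then a seminorm that vanishes
  on \<open>S\<close> and wherever all \<open>f\<^sub>j\<close> vanish. A functional dominated by \<open>q\<close> lies in the closed span of
  the \<open>f\<^sub>j\<close>, by reflexivity, and vanishes on \<open>S\<close>; hence it is zero, and so \<open>q = 0\<close>.
\<close>

section \<open>Scalars\<close>

text \<open>All that is known of the norm is that it is multiplicative and extends the absolute
  value of the reals. Multiplying by the conjugate gives \<open>a * a + b * b\<close>; the conjugate
  has norm at most \<open>\<bar>a\<bar> + \<bar>b\<bar>\<close>, and one such factor cancels against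
  \<open>(\<bar>a\<bar> + \<bar>b\<bar>)^2 \<le> 2 * (a * a + b * b)\<close>.\<close>

lemma norm_coords_le:
  fixes i :: "'k::real_normed_field"
  assumes "i * i = - 1"
  shows "\<bar>a\<bar> + \<bar>b\<bar> \<le> 2 * norm (of_real a + of_real b * i)"
proof -
  let ?N = "norm (of_real a + of_real b * i)"
  have "norm i * norm i = 1"
    using assms by (metis norm_minus_cancel norm_mult norm_one)
  then have ni: "norm i = 1"
    by (metis abs_norm_cancel abs_square_eq_1 power2_eq_square)
  have "(of_real a + of_real b * i) * (of_real a - of_real b * i)
      = of_real a * of_real a - of_real b * of_real b * (i * i)"
    by (simp add: algebra_simps)
  also have "\<dots> = of_real (a * a + b * b)"
    by (simp add: assms)
  finally have "?N * norm (of_real a - of_real b * i) = norm (of_real (a * a + b * b) :: 'k)"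
    by (metis norm_mult)
  then have prod: "?N * norm (of_real a - of_real b * i) = a * a + b * b"
    by (simp only: norm_of_real) simp
  have "norm (of_real a - of_real b * i) \<le> \<bar>a\<bar> + \<bar>b\<bar>"
    by (rule norm_triangle_ineq4 [THEN order_trans]) (simp add: norm_mult ni)
  then have "a * a + b * b \<le> ?N * (\<bar>a\<bar> + \<bar>b\<bar>)"
    unfolding prod [symmetric] by (rule mult_left_mono) simp
  moreover have "(\<bar>a\<bar> + \<bar>b\<bar>) * (\<bar>a\<bar> + \<bar>b\<bar>) \<le> 2 * (a * a + b * b)"
    using zero_le_square [of "\<bar>a\<bar> - \<bar>b\<bar>"] by (simp add: algebra_simps)
  ultimately have *: "(\<bar>a\<bar> + \<bar>b\<bar>) * (\<bar>a\<bar> + \<bar>b\<bar>) \<le> (2 * ?N) * (\<bar>a\<bar> + \<bar>b\<bar>)"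
    unfolding mult.assoc by (smt (verit))
  show ?thesis
  proof (cases "\<bar>a\<bar> + \<bar>b\<bar> = 0")
    case False
    then have "\<bar>a\<bar> + \<bar>b\<bar> > 0"
      by linarith
    then show ?thesis
      using * mult_le_cancel_right_pos by blast
  next
    case True
    then show ?thesis
      using norm_ge_zero [of "of_real a + of_real b * i"] by linarith
  qed
qed

text \<open>Treats both scalar fields at once: bounded real coordinates let facts about pairs of
  reals be transferred. In the real case \<open>i\<close> is 0.\<close>

lemma scalar_coords:
  obtains i :: "'k::real_or_complex"
  where "\<And>z. \<exists>a b. z = of_real a + of_real b * i \<and> \<bar>a\<bar> + \<bar>b\<bar> \<le> 2 * norm z"
proof (cases "\<forall>z::'k. \<exists>a. z = a *\<^sub>R 1")
  case True
  have "\<exists>a b. z = of_real a + of_real b * 0 \<and> \<bar>a\<bar> + \<bar>b\<bar> \<le> 2 * norm z" for z :: 'k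
  proof -
    obtain a where "z = a *\<^sub>R 1"
      using True by blast
    then show ?thesis
      by (intro exI [of _ a] exI [of _ 0]) (simp add: of_real_def)
  qed
  then show ?thesis
    using that by blast
next
  case False
  then obtain i :: 'k where i: "i * i = - 1" "\<And>z. \<exists>a b. z = a *\<^sub>R 1 + b *\<^sub>R i"
    using real_or_complex by blast
  have "\<exists>a b. z = of_real a + of_real b * i \<and> \<bar>a\<bar> + \<bar>b\<bar> \<le> 2 * norm z" for z :: 'k
  proof -
    obtain a b where "z = a *\<^sub>R 1 + b *\<^sub>R i"
      using i by blast
    then have "z = of_real a + of_real b * i"
      by (simp add: of_real_def)
    then show ?thesis
      using norm_coords_le [OF i(1), of a b] by blast
  qed
  then show ?thesis
    using that by blast
qed

text \<open>Coordinates of a bounded sequence form a bounded sequence of real pairs. The instance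
  supplies both completeness of the scalars and the diagonal argument for functionals below.\<close>

instance real_or_complex \<subseteq> heine_borel
proof
  fix f :: "nat \<Rightarrow> 'a"
  assume "bounded (range f)"
  then obtain M where M: "\<And>n. norm (f n) \<le> M"
    by (auto simp: bounded_iff)
  obtain i :: 'a where "\<And>z. \<exists>a b. z = of_real a + of_real b * i \<and> \<bar>a\<bar> + \<bar>b\<bar> \<le> 2 * norm z"
    by (rule scalar_coords) blast
  then obtain a b where ab: "\<And>z. z = of_real (a z) + of_real (b z) * i"
    "\<And>z. \<bar>a z\<bar> + \<bar>b z\<bar> \<le> 2 * norm z"
    by metis
  let ?p = "\<lambda>n. (a (f n), b (f n))"
  have "norm (?p n) \<le> 2 * M" for n
    using norm_Pair_le [of "a (f n)" "b (f n)"] ab(2) [of "f n"] M [of n] by simp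
  then have "bounded (range ?p)"
    by (auto simp: bounded_iff)
  then obtain l r where r: "strict_mono r" "(?p \<circ> r) \<longlonglongrightarrow> l"
    using bounded_imp_convergent_subsequence by blast
  have "(\<lambda>n. a (f (r n))) \<longlonglongrightarrow> fst l" "(\<lambda>n. b (f (r n))) \<longlonglongrightarrow> snd l"
    using tendsto_fst [OF r(2)] tendsto_snd [OF r(2)] by (simp_all add: o_def)
  then have "(\<lambda>n. of_real (a (f (r n))) + of_real (b (f (r n))) * i)
      \<longlonglongrightarrow> of_real (fst l) + of_real (snd l) * i"
    by (intro tendsto_intros)
  then have "(f \<circ> r) \<longlonglongrightarrow> of_real (fst l) + of_real (snd l) * i"
    using ab(1) by (simp add: o_def)
  then show "\<exists>l r. strict_mono (r::nat \<Rightarrow> nat) \<and> (f \<circ> r) \<longlonglongrightarrow> l"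
    using r(1) by blast
qed

lemma countable_dense_scalars:
  obtains Q :: "'k::real_or_complex set"
  where "countable Q" "\<And>z e. 0 < e \<Longrightarrow> \<exists>q\<in>Q. norm (z - q) < e"
proof -
  obtain i :: 'k where i: "\<And>z. \<exists>a b. z = of_real a + of_real b * i \<and> \<bar>a\<bar> + \<bar>b\<bar> \<le> 2 * norm z"
    by (rule scalar_coords) blast
  define Q where "Q = (\<lambda>(a, b). of_real a + of_real b * i) ` (\<rat> \<times> \<rat>)"
  have "\<exists>q\<in>Q. norm (z - q) < e" if "0 < e" for z e
  proof -
    obtain a b where z: "z = of_real a + of_real b * i"
      using i by blast
    \<comment> \<open>With both coordinates off by less than \<open>d\<close>, the total error stays
      below \<open>d + d * norm i = e\<close>.\<close>
    define d where "d = e / (1 + norm i)"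
    have "1 + norm i > 0"
      using norm_ge_zero [of i] by linarith
    then have d: "d > 0" "d * (1 + norm i) = e"
      using that by (auto simp: d_def)
    obtain s where s: "s \<in> \<rat>" "\<bar>a - s\<bar> < d"
      using Rats_dense_in_real [of "a - d" a] d(1) by (auto simp: abs_less_iff)
    obtain t where t: "t \<in> \<rat>" "\<bar>b - t\<bar> < d"
      using Rats_dense_in_real [of "b - d" b] d(1) by (auto simp: abs_less_iff)
    have "z - (of_real s + of_real t * i) = of_real (a - s) + of_real (b - t) * i"
      by (simp add: z algebra_simps)
    then have "norm (z - (of_real s + of_real t * i)) \<le> \<bar>a - s\<bar> + \<bar>b - t\<bar> * norm i"
      by (metis norm_mult norm_of_real norm_triangle_ineq)
    also have "\<dots> < d + d * norm i"
      using s t by (intro add_less_le_mono mult_right_mono) auto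
    also have "\<dots> = e"
      using d(2) by (simp add: algebra_simps)
    finally show ?thesis
      using s t by (auto simp: Q_def)
  qed
  moreover have "countable Q"
    by (auto simp: Q_def intro: countable_rat)
  ultimately show ?thesis
    using that by blast
qed

lemma scalars_simps [simp]:
  "carrier scalars = UNIV" "x \<otimes>\<^bsub>scalars\<^esub> y = x * y" "\<one>\<^bsub>scalars\<^esub> = 1"
  "\<zero>\<^bsub>scalars\<^esub> = 0" "x \<oplus>\<^bsub>scalars\<^esub> y = x + y" "c \<odot>\<^bsub>scalars\<^esub> x = c * x"
  "nrm scalars = norm"
  by (simp_all add: scalars_def)

lemma abelian_group_scalars: "abelian_group scalars"
  by (rule abelian_groupI) (auto intro: exI [of _ "- x" for x])

lemma cring_scalars: "cring scalars"
  by (intro cringI abelian_group_scalars comm_monoidI) (auto simp: algebra_simps)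

lemma a_inv_scalars [simp]: "\<ominus>\<^bsub>scalars\<^esub> x = - x"
proof -
  interpret abelian_group scalars
    by (rule abelian_group_scalars)
  show ?thesis
    using minus_equality [of "- x" x] by simp
qed

lemma a_minus_scalars [simp]: "x \<ominus>\<^bsub>scalars\<^esub> y = x - y"
  by (simp add: a_minus_def)

section \<open>The Hahn-Banach theorem\<close>

text \<open>The norm stays out of this locale: Hahn-Banach is needed for several seminorms besides
  it.\<close>

locale kmodule = Module.module scalars X
  for X :: "('k::real_or_complex, 'a) normed_space"
begin

abbreviation scale (infixr \<open>\<cdot>\<close> 75) where "c \<cdot> x \<equiv> c \<odot>\<^bsub>X\<^esub> x"
abbreviation plus (infixl \<open>\<^bold>+\<close> 65) where "x \<^bold>+ y \<equiv> x \<oplus>\<^bsub>X\<^esub> y"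
abbreviation mns (infixl \<open>\<^bold>-\<close> 65) where "x \<^bold>- y \<equiv> x \<ominus>\<^bsub>X\<^esub> y"
abbreviation C where "C \<equiv> carrier X"
abbreviation nul where "nul \<equiv> \<zero>\<^bsub>X\<^esub>"

lemma scale_closed [simp, intro]: "x \<in> C \<Longrightarrow> c \<cdot> x \<in> C"
  by simp

lemma scale_assoc: "x \<in> C \<Longrightarrow> c \<cdot> d \<cdot> x = (c * d) \<cdot> x"
  using smult_assoc1 [of c d x] by simp

lemma scale_one [simp]: "x \<in> C \<Longrightarrow> 1 \<cdot> x = x"
  using smult_one [of x] by simp

lemma scale_zero [simp]: "x \<in> C \<Longrightarrow> 0 \<cdot> x = nul"
  using smult_l_null [of x] by simp

lemma scale_nul [simp]: "c \<cdot> nul = nul"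
  using smult_r_null [of c] by simp

lemma scale_add_left: "x \<in> C \<Longrightarrow> (c + d) \<cdot> x = c \<cdot> x \<^bold>+ d \<cdot> x"
  using smult_l_distr [of c d x] by simp

lemma scale_add_right: "\<lbrakk>x \<in> C; y \<in> C\<rbrakk> \<Longrightarrow> c \<cdot> (x \<^bold>+ y) = c \<cdot> x \<^bold>+ c \<cdot> y"
  using smult_r_distr [of c x y] by simp

lemma scale_minus_one: "x \<in> C \<Longrightarrow> (- 1) \<cdot> x = \<ominus>\<^bsub>X\<^esub> x"
  using smult_l_minus [of 1 x] by simp

lemma minus_eq_scale: "y \<in> C \<Longrightarrow> x \<^bold>- y = x \<^bold>+ (- 1) \<cdot> y"
  by (simp add: scale_minus_one a_minus_def)

lemma scale_minus_cancel: "x \<in> C \<Longrightarrow> x \<^bold>+ (- 1) \<cdot> x = nul"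
  by (simp add: scale_minus_one M.r_neg)

end

text \<open>Homogeneity is stated as an inequality only, which is easy to check for infima; scaling
  back by \<open>1 / t\<close> recovers equality. The same holds for \<open>seminorm\<close>, whose
  nonnegativity is derived as well.\<close>

definition sublinear where
  "sublinear X p \<longleftrightarrow>
     (\<forall>x\<in>carrier X. \<forall>y\<in>carrier X. p (x \<oplus>\<^bsub>X\<^esub> y) \<le> p x + (p y :: real)) \<and>
     (\<forall>t>0. \<forall>x\<in>carrier X. p (of_real t \<odot>\<^bsub>X\<^esub> x) \<le> t * p x)"

definition seminorm where
  "seminorm X p \<longleftrightarrow>
     (\<forall>x\<in>carrier X. \<forall>y\<in>carrier X. p (x \<oplus>\<^bsub>X\<^esub> y) \<le> p x + (p y :: real)) \<and>
     (\<forall>c. \<forall>x\<in>carrier X. p (c \<odot>\<^bsub>X\<^esub> x) \<le> norm c * p x)"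

section \<open>Linear functionals below a sublinear function\<close>

context kmodule
begin

lemma sublinearD:
  assumes "sublinear X p"
  shows "\<lbrakk>x \<in> C; y \<in> C\<rbrakk> \<Longrightarrow> p (x \<^bold>+ y) \<le> p x + p y"
    and "\<lbrakk>t \<ge> 0; x \<in> C\<rbrakk> \<Longrightarrow> p (of_real t \<cdot> x) = t * p x"
    and "p nul = 0"
    and "x \<in> C \<Longrightarrow> - p ((- 1) \<cdot> x) \<le> p x"
proof -
  have p: "\<And>x y. \<lbrakk>x \<in> C; y \<in> C\<rbrakk> \<Longrightarrow> p (x \<^bold>+ y) \<le> p x + p y"
    "\<And>t x. \<lbrakk>t > 0; x \<in> C\<rbrakk> \<Longrightarrow> p (of_real t \<cdot> x) \<le> t * p x"
    using assms by (auto simp: sublinear_def)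
  \<comment> \<open>Subadditivity gives \<open>p nul \<ge> 0\<close>, and the factor 1/2 gives
    \<open>p nul \<le> 0\<close>.\<close>
  show p0: "p nul = 0"
    using p(1) [of nul nul] p(2) [of "1/2" nul] by simp
  show "p (x \<^bold>+ y) \<le> p x + p y" if "x \<in> C" "y \<in> C"
    using p(1) that .
  show "- p ((- 1) \<cdot> x) \<le> p x" if "x \<in> C"
    using p(1) [of x "(- 1) \<cdot> x"] that by (simp add: scale_minus_cancel p0)
  show "p (of_real t \<cdot> x) = t * p x" if "t \<ge> 0" "x \<in> C"
  proof (cases "t = 0")
    case True
    then show ?thesis
      using that p0 by simp
  next
    case False
    then have t: "t > 0"
      using that by simp
    have "of_real (1 / t) \<cdot> (of_real t \<cdot> x) = x"
      using t that by (simp only: scale_assoc) (simp flip: of_real_mult)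
    then have "p x \<le> 1 / t * p (of_real t \<cdot> x)"
      using p(2) [of "1 / t" "of_real t \<cdot> x"] t that by simp
    then have "t * p x \<le> p (of_real t \<cdot> x)"
      using t by (simp add: field_simps)
    then show ?thesis
      using p(2) t that by force
  qed
qed

text \<open>Minimise \<open>p (x + t y) - t p y\<close> over \<open>t \<ge> 0\<close>. The infimum
  is finite because \<open>- p (- x)\<close> is a lower bound; \<open>t = 0\<close> shows that it is
  below \<open>p\<close>, and \<open>t = 1\<close> at \<open>- y\<close> gives the required
  value.\<close>

lemma sublinear_tilt:
  assumes p: "sublinear X p" and y: "y \<in> C"
  obtains q where "sublinear X q" "\<And>x. x \<in> C \<Longrightarrow> q x \<le> p x" "q ((- 1) \<cdot> y) \<le> - p y"
proof -
  define q where "q x = (INF t\<in>{0..}. p (x \<^bold>+ of_real t \<cdot> y) - t * p y)" for x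
  have lower: "- p ((- 1) \<cdot> x) \<le> p (x \<^bold>+ of_real t \<cdot> y) - t * p y" if "x \<in> C" "t \<ge> 0" for x t
  proof -
    have "(x \<^bold>+ of_real t \<cdot> y) \<^bold>+ (- 1) \<cdot> x = of_real t \<cdot> y"
      using that y by (simp add: scale_minus_one M.add.m_assoc M.add.m_comm M.r_neg1 M.r_neg2)
    then have "t * p y \<le> p (x \<^bold>+ of_real t \<cdot> y) + p ((- 1) \<cdot> x)"
      using sublinearD(1) [OF p, of "x \<^bold>+ of_real t \<cdot> y" "(- 1) \<cdot> x"]
        sublinearD(2) [OF p \<open>t \<ge> 0\<close> y] that y by simp
    then show ?thesis
      by linarith
  qed
  have qle: "q x \<le> p (x \<^bold>+ of_real t \<cdot> y) - t * p y" if "x \<in> C" "t \<ge> 0" for x t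
    unfolding q_def using that lower by (intro cINF_lower bdd_belowI2) auto
  have geq: "b \<le> q x" if "\<And>t. t \<ge> 0 \<Longrightarrow> b \<le> p (x \<^bold>+ of_real t \<cdot> y) - t * p y" for x b
    unfolding q_def using that by (intro cINF_greatest) auto
  have qp: "q x \<le> p x" if "x \<in> C" for x
    using qle [OF that, of 0] that y by simp
  have "q ((- 1) \<cdot> y) \<le> - p y"
    using qle [of "(- 1) \<cdot> y" 1] y sublinearD(3) [OF p]
    by (simp add: scale_minus_one M.l_neg)
  moreover have "q (x \<^bold>+ z) \<le> q x + q z" if "x \<in> C" "z \<in> C" for x z
  proof -
    \<comment> \<open>Parameters \<open>s\<close> for \<open>x\<close> and \<open>t\<close> for
      \<open>z\<close> combine to \<open>s + t\<close> for the sum.\<close>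
    have *: "q (x \<^bold>+ z) \<le> (p (x \<^bold>+ of_real s \<cdot> y) - s * p y) + (p (z \<^bold>+ of_real t \<cdot> y) - t * p y)"
      if "s \<ge> 0" "t \<ge> 0" for s t
    proof -
      have "(x \<^bold>+ z) \<^bold>+ of_real (s + t) \<cdot> y = (x \<^bold>+ of_real s \<cdot> y) \<^bold>+ (z \<^bold>+ of_real t \<cdot> y)"
        using \<open>x \<in> C\<close> \<open>z \<in> C\<close> y by (simp add: scale_add_left M.add.m_ac)
      then have "q (x \<^bold>+ z) \<le> p ((x \<^bold>+ of_real s \<cdot> y) \<^bold>+ (z \<^bold>+ of_real t \<cdot> y)) - (s + t) * p y"
        using qle [of "x \<^bold>+ z" "s + t"] \<open>x \<in> C\<close> \<open>z \<in> C\<close> that by simp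
      then show ?thesis
        using sublinearD(1) [OF p, of "x \<^bold>+ of_real s \<cdot> y" "z \<^bold>+ of_real t \<cdot> y"]
          \<open>x \<in> C\<close> \<open>z \<in> C\<close> y by (simp add: algebra_simps)
    qed
    \<comment> \<open>The two infima are taken one after the other: first over \<open>t\<close> with
      \<open>s\<close> fixed, then over \<open>s\<close>.\<close>
    have "q (x \<^bold>+ z) - (p (x \<^bold>+ of_real s \<cdot> y) - s * p y) \<le> q z" if "s \<ge> 0" for s
      using * [OF that] by (intro geq) (simp add: algebra_simps)
    then have "q (x \<^bold>+ z) - q z \<le> q x"
      by (intro geq) (simp add: algebra_simps)
    then show ?thesis
      by simp
  qed
  moreover have "q (of_real r \<cdot> x) \<le> r * q x" if r: "r > 0" and x: "x \<in> C" for r x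
  proof -
    have "q (of_real r \<cdot> x) / r \<le> q x"
    proof (rule geq)
      fix t :: real
      assume "t \<ge> 0"
      \<comment> \<open>The parameter \<open>t\<close> at \<open>x\<close> corresponds to
        \<open>r * t\<close> at \<open>r x\<close>.\<close>
      have "of_real r \<cdot> x \<^bold>+ of_real (r * t) \<cdot> y = of_real r \<cdot> (x \<^bold>+ of_real t \<cdot> y)"
        using x y by (simp add: scale_add_right scale_assoc)
      then have "q (of_real r \<cdot> x) \<le> r * p (x \<^bold>+ of_real t \<cdot> y) - r * t * p y"
        using qle [of "of_real r \<cdot> x" "r * t"] r x y \<open>t \<ge> 0\<close> sublinearD(2) [OF p, of r]
        by simp
      then show "q (of_real r \<cdot> x) / r \<le> p (x \<^bold>+ of_real t \<cdot> y) - t * p y"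
        using r by (simp add: field_simps)
    qed
    then show ?thesis
      using r by (simp add: field_simps)
  qed
  ultimately show ?thesis
    using that [of q] qp by (simp add: sublinear_def)
qed

text \<open>Zorn's lemma: the pointwise infimum of a nonempty chain of sublinear functions below
  \<open>p\<close> is again one of them.\<close>

lemma minimal_sublinear:
  assumes p: "sublinear X p"
  obtains u where "sublinear X u" "\<And>x. x \<in> C \<Longrightarrow> u x \<le> p x"
    "\<And>q x. \<lbrakk>sublinear X q; \<And>x. x \<in> C \<Longrightarrow> q x \<le> u x; x \<in> C\<rbrakk> \<Longrightarrow> q x = u x"
proof -
  \<comment> \<open>Extensionality makes the pointwise order on \<open>C\<close>
    antisymmetric.\<close>
  define A where "A = {q \<in> extensional C. sublinear X q \<and> (\<forall>x\<in>C. q x \<le> p x)}"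
  \<comment> \<open>The order is reversed, so that a maximal element is a minimal function.\<close>
  define P where "P q r \<longleftrightarrow> (\<forall>x\<in>C. r x \<le> q x)" for q r :: "'a \<Rightarrow> real"
  have restr: "sublinear X (restrict q C)" if "sublinear X q" for q
    using that by (auto simp: sublinear_def)
  have pA: "restrict p C \<in> A"
    using p restr by (auto simp: A_def)
  have "\<exists>u\<in>A. \<forall>q\<in>A. P u q \<longrightarrow> q = u"
  proof (rule predicate_Zorn)
    show "partial_order_on A (relation_of P A)"
    proof (rule partial_order_on_relation_ofI)
      fix a b
      assume "a \<in> A" "b \<in> A" "P a b" "P b a"
      then show "a = b"
        by (intro extensionalityI [of a C b]) (auto simp: A_def P_def intro: order_antisym)
    next
      fix a b c
      assume "P a b" and "P b c"
      then show "P a c"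
        unfolding P_def by (meson order_trans)
    qed (auto simp: P_def)
  next
    fix K
    assume "K \<in> Chains (relation_of P A)"
    then have KA: "K \<subseteq> A" and lin: "\<And>a b. \<lbrakk>a \<in> K; b \<in> K\<rbrakk> \<Longrightarrow> P a b \<or> P b a"
      by (auto simp: Chains_def relation_of_def)
    show "\<exists>u\<in>A. \<forall>a\<in>K. P a u"
    proof (cases "K = {}")
      case True
      then show ?thesis
        using pA by blast
    next
      case ne: False
      define u where "u = (\<lambda>x\<in>C. INF q\<in>K. q x)"
      \<comment> \<open>A bound independent of \<open>q\<close>, so that the infimum over the chain
        is finite.\<close>
      have lower: "- p ((- 1) \<cdot> x) \<le> q x" if "q \<in> K" "x \<in> C" for q x
      proof -
        have "q ((- 1) \<cdot> x) \<le> p ((- 1) \<cdot> x)" "sublinear X q"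
          using that KA by (auto simp: A_def)
        then show ?thesis
          using sublinearD(4) [of q x] that by linarith
      qed
      have ule: "u x \<le> q x" if "q \<in> K" "x \<in> C" for q x
        using that lower by (auto simp: u_def intro!: cINF_lower bdd_belowI2)
      have geu: "b \<le> u x" if "x \<in> C" "\<And>q. q \<in> K \<Longrightarrow> b \<le> q x" for b x
        using that ne by (auto simp: u_def intro!: cINF_greatest)
      have Ksub: "sublinear X q" if "q \<in> K" for q
        using that KA by (auto simp: A_def)
      have "u (x \<^bold>+ y) \<le> u x + u y" if xy: "x \<in> C" "y \<in> C" for x y
      proof -
        have *: "u (x \<^bold>+ y) \<le> a x + b y" if ab: "a \<in> K" "b \<in> K" for a b
        proof -
          \<comment> \<open>The smaller of two members of the chain serves both points.\<close>
          obtain c where c: "c \<in> K" "c x \<le> a x" "c y \<le> b y"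
            using lin [OF ab] ab xy unfolding P_def by blast
          show ?thesis
            using ule [OF c(1), of "x \<^bold>+ y"] sublinearD(1) [OF Ksub [OF c(1)] xy] c xy by simp
        qed
        have "u (x \<^bold>+ y) - a x \<le> u y" if "a \<in> K" for a
          using * [OF that] xy by (intro geu) (simp_all add: algebra_simps)
        then have "u (x \<^bold>+ y) - u y \<le> u x"
          using xy by (intro geu) (simp_all add: algebra_simps)
        then show ?thesis
          by simp
      qed
      moreover have "u (of_real t \<cdot> x) \<le> t * u x" if t: "t > 0" "x \<in> C" for t x
      proof -
        have "u (of_real t \<cdot> x) / t \<le> u x"
        proof (rule geu)
          fix q
          assume q: "q \<in> K"
          then have "u (of_real t \<cdot> x) \<le> t * q x"
            using ule [OF q, of "of_real t \<cdot> x"] sublinearD(2) [OF Ksub [OF q], of t x] t by simp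
          then show "u (of_real t \<cdot> x) / t \<le> q x"
            using t by (simp add: field_simps)
        qed (use t in auto)
        then show ?thesis
          using t by (simp add: field_simps)
      qed
      ultimately have "sublinear X u"
        by (simp add: sublinear_def)
      moreover have "u x \<le> p x" if "x \<in> C" for x
      proof -
        obtain q where "q \<in> K"
          using ne by blast
        then show ?thesis
          using ule [of q x] KA that by (force simp: A_def)
      qed
      ultimately have "u \<in> A"
        by (simp add: A_def u_def)
      then show ?thesis
        using ule by (auto simp: P_def)
    qed
  qed
  then obtain u where u: "u \<in> A" "\<And>q. \<lbrakk>q \<in> A; P u q\<rbrakk> \<Longrightarrow> q = u"
    by blast
  show ?thesis
  proof
    show "sublinear X u" "\<And>x. x \<in> C \<Longrightarrow> u x \<le> p x"
      using u(1) by (auto simp: A_def)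
    fix q x
    assume q: "sublinear X q" "\<And>x. x \<in> C \<Longrightarrow> q x \<le> u x" and "x \<in> C"
    have "restrict q C \<in> A"
      using q restr u(1) unfolding A_def by (auto intro: order_trans)
    then have "restrict q C = u"
      using u(2) q by (auto simp: P_def)
    then show "q x = u x"
      using \<open>x \<in> C\<close> by (metis restrict_apply')
  qed
qed

text \<open>A minimal sublinear function cannot be tilted, so it is odd and hence linear.\<close>

lemma real_Hahn_Banach:
  assumes p: "sublinear X p" and x0: "x0 \<in> C"
  obtains u where "\<And>x y. \<lbrakk>x \<in> C; y \<in> C\<rbrakk> \<Longrightarrow> u (x \<^bold>+ y) = u x + u y"
    "\<And>t x. x \<in> C \<Longrightarrow> u (of_real t \<cdot> x) = t * u x"
    "\<And>x. x \<in> C \<Longrightarrow> u x \<le> p x" "u x0 = p x0"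
proof -
  \<comment> \<open>Tilting first forces the value at \<open>x0\<close>: an odd function below
    \<open>p'\<close> is at least \<open>p x0\<close> there.\<close>
  obtain p' where p': "sublinear X p'" "\<And>x. x \<in> C \<Longrightarrow> p' x \<le> p x" "p' ((- 1) \<cdot> x0) \<le> - p x0"
    using sublinear_tilt [OF p x0] by blast
  obtain u where u: "sublinear X u" "\<And>x. x \<in> C \<Longrightarrow> u x \<le> p' x"
    "\<And>q x. \<lbrakk>sublinear X q; \<And>x. x \<in> C \<Longrightarrow> q x \<le> u x; x \<in> C\<rbrakk> \<Longrightarrow> q x = u x"
    using minimal_sublinear [OF p'(1)] by blast
  have neg: "u ((- 1) \<cdot> y) = - u y" if y: "y \<in> C" for y
  proof -
    obtain q where q: "sublinear X q" "\<And>x. x \<in> C \<Longrightarrow> q x \<le> u x" "q ((- 1) \<cdot> y) \<le> - u y"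
      using sublinear_tilt [OF u(1) y] by blast
    then have "u ((- 1) \<cdot> y) \<le> - u y"
      using u(3) [of q "(- 1) \<cdot> y"] y by simp
    then show ?thesis
      using sublinearD(4) [OF u(1) y] by simp
  qed
  have add: "u (x \<^bold>+ y) = u x + u y" if xy: "x \<in> C" "y \<in> C" for x y
  proof -
    have "(- 1) \<cdot> (x \<^bold>+ y) = (- 1) \<cdot> x \<^bold>+ (- 1) \<cdot> y"
      using xy by (simp add: scale_add_right)
    then have "- u (x \<^bold>+ y) \<le> - u x - u y"
      using sublinearD(1) [OF u(1), of "(- 1) \<cdot> x" "(- 1) \<cdot> y"] xy neg [of "x \<^bold>+ y"]
        neg [of x] neg [of y] by simp
    then show ?thesis
      using sublinearD(1) [OF u(1) xy] by simp
  qed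
  have "u (of_real t \<cdot> x) = t * u x" if x: "x \<in> C" for t x
  proof (cases "t \<ge> 0")
    case True
    then show ?thesis
      using sublinearD(2) [OF u(1)] x by blast
  next
    case False
    have "of_real t \<cdot> x = (- 1) \<cdot> (of_real (- t) \<cdot> x)"
      using x by (simp only: scale_assoc) simp
    then show ?thesis
      using neg [of "of_real (- t) \<cdot> x"] sublinearD(2) [OF u(1), of "- t" x] False x by simp
  qed
  moreover have "u x \<le> p x" if "x \<in> C" for x
    using u(2) p'(2) that by (meson order_trans)
  moreover have "u x0 \<ge> p x0"
    using u(2) [of "(- 1) \<cdot> x0"] p'(3) neg [OF x0] x0 by simp
  ultimately show ?thesis
    using that [of u] add x0 by force
qed

section \<open>Scalar-valued functionals below a seminorm\<close>

lemma seminormD: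
  assumes "seminorm X p"
  shows "\<lbrakk>x \<in> C; y \<in> C\<rbrakk> \<Longrightarrow> p (x \<^bold>+ y) \<le> p x + p y"
    and "x \<in> C \<Longrightarrow> p (c \<cdot> x) = norm c * p x"
    and "x \<in> C \<Longrightarrow> 0 \<le> p x"
    and "sublinear X p"
proof -
  have p: "\<And>x y. \<lbrakk>x \<in> C; y \<in> C\<rbrakk> \<Longrightarrow> p (x \<^bold>+ y) \<le> p x + p y"
    "\<And>c x. x \<in> C \<Longrightarrow> p (c \<cdot> x) \<le> norm c * p x"
    using assms by (auto simp: seminorm_def)
  show "p (x \<^bold>+ y) \<le> p x + p y" if "x \<in> C" "y \<in> C"
    using p(1) that .
  have s: "sublinear X p"
    unfolding sublinear_def using p(1) p(2) [of _ "of_real t" for t] by (metis abs_of_pos norm_of_real)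
  then show "sublinear X p" .
  show "0 \<le> p x" if "x \<in> C"
    using sublinearD(4) [OF s that] p(2) [OF that, of "- 1"] by simp
  show "p (c \<cdot> x) = norm c * p x" if x: "x \<in> C"
  proof (cases "c = 0")
    case True
    then show ?thesis
      using x sublinearD(3) [OF s] by simp
  next
    case False
    have "inverse c \<cdot> (c \<cdot> x) = x"
      using x False by (simp add: scale_assoc)
    then have "p x \<le> norm (inverse c) * p (c \<cdot> x)"
      using p(2) [of "c \<cdot> x" "inverse c"] x by simp
    then have "norm c * p x \<le> p (c \<cdot> x)"
      using False by (simp add: norm_inverse norm_divide field_simps)
    then show ?thesis
      using p(2) [OF x] by (rule order_antisym [rotated])
  qed
qed

text \<open>
  In the complex case \<open>g x = u x - i u (i x)\<close> as usual. The factor 2 is an artefact of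
  \<open>norm_coords_le\<close>, which spares us the proof that the norm of the scalars is the
  usual one.
\<close>

lemma Hahn_Banach:
  assumes p: "seminorm X p" and x0: "x0 \<in> C"
  obtains g where "is_linear X scalars g" "\<And>x. x \<in> C \<Longrightarrow> norm (g x) \<le> p x"
    "p x0 \<le> 2 * norm (g x0)"
proof -
  obtain u where u: "\<And>x y. \<lbrakk>x \<in> C; y \<in> C\<rbrakk> \<Longrightarrow> u (x \<^bold>+ y) = u x + u y"
    "\<And>t x. x \<in> C \<Longrightarrow> u (of_real t \<cdot> x) = t * u x"
    "\<And>x. x \<in> C \<Longrightarrow> u x \<le> p x" "u x0 = p x0"
    using real_Hahn_Banach [OF seminormD(4) [OF p] x0] by blast
  \<comment> \<open>The interface between the two scalar fields: that \<open>u\<close> agrees with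
    \<open>g\<close> wherever \<open>g\<close> has a nonnegative real value is enough for the norm
    bound.\<close>
  have "\<exists>g. is_linear X scalars g \<and> (\<forall>x\<in>C. \<forall>t\<ge>0. g x = of_real t \<longrightarrow> u x = t) \<and>
      \<bar>u x0\<bar> \<le> 2 * norm (g x0)"
  proof (cases "\<forall>z::'k. \<exists>a. z = a *\<^sub>R 1")
    case True
    have "u (c \<cdot> x) *\<^sub>R 1 = c * (u x *\<^sub>R 1)" if x: "x \<in> C" for c x
    proof -
      obtain a where "c = of_real a"
        using True by (metis of_real_def)
      then show ?thesis
        using u(2) [OF x, of a] by (simp add: of_real_def)
    qed
    then have "is_linear X scalars (\<lambda>x. of_real (u x))"
      using u(1) by (simp add: is_linear_def of_real_def scaleR_add_left)
    then show ?thesis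
      by (intro exI [of _ "\<lambda>x. of_real (u x)"]) simp
  next
    case False
    then obtain i :: 'k where i: "i * i = - 1" "\<And>z. \<exists>a b. z = a *\<^sub>R 1 + b *\<^sub>R i"
      using real_or_complex by blast
    define g where "g x = of_real (u x) + of_real (- u (i \<cdot> x)) * i" for x
    have g_add: "g (x \<^bold>+ y) = g x + g y" if "x \<in> C" "y \<in> C" for x y
      using that by (simp add: g_def u(1) scale_add_right algebra_simps)
    have g_real: "g (of_real t \<cdot> x) = of_real t * g x" if "x \<in> C" for t x
    proof -
      have "i \<cdot> of_real t \<cdot> x = of_real t \<cdot> i \<cdot> x"
        using that by (simp add: scale_assoc mult.commute)
      then show ?thesis
        using that by (simp add: g_def u(2) algebra_simps)
    qed
    have g_i: "g (i \<cdot> x) = i * g x" if "x \<in> C" for x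
    proof -
      have "i \<cdot> i \<cdot> x = of_real (- 1) \<cdot> x"
        using that by (simp add: scale_assoc i(1))
      then have "u (i \<cdot> i \<cdot> x) = - u x"
        using u(2) [OF that, of "- 1"] by simp
      moreover have "i * (of_real (- u (i \<cdot> x)) * i) = of_real (u (i \<cdot> x))"
        using i(1) by (simp add: mult.left_commute [of i])
      ultimately show ?thesis
        by (simp add: g_def distrib_left mult.commute right_diff_distrib)
    qed
    have "g (c \<cdot> x) = c * g x" if x: "x \<in> C" for c x
    proof -
      obtain a b where "c = a *\<^sub>R 1 + b *\<^sub>R i"
        using i(2) by blast
      then have c: "c = of_real a + of_real b * i"
        by (simp add: of_real_def)
      have "c \<cdot> x = of_real a \<cdot> x \<^bold>+ of_real b \<cdot> i \<cdot> x"
        using x by (simp add: c scale_add_left scale_assoc)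
      then show ?thesis
        using x by (simp add: g_add g_real g_i) (simp add: c algebra_simps)
    qed
    then have "is_linear X scalars g"
      using g_add by (simp add: is_linear_def)
    moreover have "u x = t" if "x \<in> C" "g x = of_real t" for x t
    proof -
      \<comment> \<open>By \<open>norm_coords_le\<close>, a vanishing combination has vanishing
        coordinates.\<close>
      have "of_real (u x - t) + of_real (- u (i \<cdot> x)) * i = 0"
        using that(2) by (simp add: g_def algebra_simps)
      then show ?thesis
        using norm_coords_le [OF i(1), of "u x - t" "- u (i \<cdot> x)"] by simp
    qed
    moreover have "\<bar>u x0\<bar> \<le> 2 * norm (g x0)"
      using norm_coords_le [OF i(1), of "u x0" "- u (i \<cdot> x0)"] by (simp add: g_def)
    ultimately show ?thesis
      by blast
  qed
  then obtain g where g: "is_linear X scalars g" "\<And>x t. \<lbrakk>x \<in> C; t \<ge> 0; g x = of_real t\<rbrakk> \<Longrightarrow> u x = t"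
    "\<bar>u x0\<bar> \<le> 2 * norm (g x0)"
    by blast
  have "norm (g x) \<le> p x" if x: "x \<in> C" for x
  proof (cases "g x = 0")
    case True
    then show ?thesis
      using seminormD(3) [OF p x] by simp
  next
    case False
    \<comment> \<open>A factor of modulus one that turns \<open>g x\<close> into a nonnegative real,
      where \<open>u\<close> controls it.\<close>
    define c where "c = of_real (norm (g x)) / g x"
    have nc: "norm c = 1"
      using False by (simp add: c_def norm_divide)
    have "g (c \<cdot> x) = c * g x"
      using g(1) x by (simp add: is_linear_def)
    then have "g (c \<cdot> x) = of_real (norm (g x))"
      using False by (simp add: c_def)
    then have "u (c \<cdot> x) = norm (g x)"
      using g(2) x by simp
    then show ?thesis
      using u(3) [of "c \<cdot> x"] seminormD(2) [OF p x, of c] nc x by simp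
  qed
  then show ?thesis
    using that [of g] g(1,3) u(4) by simp
qed

end

section \<open>Normed spaces and their duals\<close>

locale nspace = kmodule X for X :: "('k::real_or_complex, 'a) normed_space" +
  assumes nrm_ge_0 [simp]: "x \<in> carrier X \<Longrightarrow> 0 \<le> nrm X x"
    and nrm_eq_0_iff: "x \<in> carrier X \<Longrightarrow> nrm X x = 0 \<longleftrightarrow> x = \<zero>\<^bsub>X\<^esub>"
    and nrm_scale: "x \<in> carrier X \<Longrightarrow> nrm X (c \<odot>\<^bsub>X\<^esub> x) = norm c * nrm X x"
    and nrm_triangle: "\<lbrakk>x \<in> carrier X; y \<in> carrier X\<rbrakk> \<Longrightarrow> nrm X (x \<oplus>\<^bsub>X\<^esub> y) \<le> nrm X x + nrm X y"

lemma nspace_iff: "nspace X \<longleftrightarrow> is_normed_space X"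
  unfolding nspace_def nspace_axioms_def kmodule_def is_normed_space_def by blast

lemma (in kmodule) minus_eq_nul_iff:
  assumes "x \<in> C" "y \<in> C"
  shows "x \<^bold>- y = nul \<longleftrightarrow> x = y"
proof
  assume "x \<^bold>- y = nul"
  then have "(x \<^bold>- y) \<^bold>+ y = y"
    using assms by simp
  then show "x = y"
    using assms by (simp add: M.minus_eq M.add.m_assoc M.l_neg)
qed (use assms in \<open>simp add: M.minus_eq M.r_neg\<close>)

sublocale nspace \<subseteq> Metric_space "carrier X" "ndist X"
proof
  show "0 \<le> ndist X x y" for x y
    by (simp add: ndist_def)
  show "ndist X x y = ndist X y x" for x y
  proof (cases "x \<in> C \<and> y \<in> C")
    case True
    then have "x \<^bold>- y = (- 1) \<cdot> (y \<^bold>- x)"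
      by (simp add: scale_minus_one M.minus_eq M.minus_add M.add.m_comm)
    then show ?thesis
      using True nrm_scale [of "y \<^bold>- x" "- 1"] by (simp add: ndist_def)
  qed (auto simp: ndist_def)
  show "ndist X x y = 0 \<longleftrightarrow> x = y" if "x \<in> C" "y \<in> C" for x y
    using that by (simp add: ndist_def nrm_eq_0_iff minus_eq_nul_iff)
  show "ndist X x z \<le> ndist X x y + ndist X y z" if "x \<in> C" "y \<in> C" "z \<in> C" for x y z
  proof -
    have "x \<^bold>- z = (x \<^bold>- y) \<^bold>+ (y \<^bold>- z)"
      using that by (simp add: M.minus_eq M.add.m_assoc M.r_neg2 M.r_neg1)
    then show ?thesis
      using that nrm_triangle [of "x \<^bold>- y" "y \<^bold>- z"] by (simp add: ndist_def)
  qed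
qed

lemma is_linearD:
  assumes "is_linear X scalars f"
  shows "\<lbrakk>x \<in> carrier X; y \<in> carrier X\<rbrakk> \<Longrightarrow> f (x \<oplus>\<^bsub>X\<^esub> y) = f x + f y"
    and "x \<in> carrier X \<Longrightarrow> f (c \<odot>\<^bsub>X\<^esub> x) = c * f x"
  using assms by (auto simp: is_linear_def)

lemma norm_topology_scalars: "norm_topology scalars = euclidean"
proof -
  have "ndist scalars = (dist :: 'a \<Rightarrow> 'a \<Rightarrow> real)"
    by (simp add: fun_eq_iff ndist_def dist_norm)
  then show ?thesis
    by (simp add: norm_topology_def)
qed

context nspace
begin

lemma norm_topology_eq: "norm_topology X = mtopology"
  by (simp add: norm_topology_def)

lemma ndist_eq: "\<lbrakk>x \<in> C; y \<in> C\<rbrakk> \<Longrightarrow> ndist X x y = nrm X (x \<^bold>- y)"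
  by (simp add: ndist_def)

lemma nrm_nul [simp]: "nrm X nul = 0"
  by (simp add: nrm_eq_0_iff)

lemma linear_minus:
  "\<lbrakk>is_linear X scalars f; x \<in> C; y \<in> C\<rbrakk> \<Longrightarrow> f (x \<^bold>- y) = f x - f y"
  using is_linearD(1) [of X f x "(- 1) \<cdot> y"] is_linearD(2) [of X f y "- 1"]
  by (simp add: minus_eq_scale)

lemma linear_nul: "is_linear X scalars f \<Longrightarrow> f nul = 0"
  using is_linearD(2) [of X f nul 0] by simp

text \<open>Rescale \<open>x\<close> to norm \<open>r / 2\<close>, strictly inside the ball; this
  costs the factor 2. It serves continuity at zero as well as the ball from Baire's theorem.\<close>

lemma linear_bound_of_ball:
  assumes f: "is_linear X scalars f" and r: "r > 0"
    and K: "\<And>x. \<lbrakk>x \<in> C; nrm X x < r\<rbrakk> \<Longrightarrow> norm (f x) \<le> K"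
    and x: "x \<in> C"
  shows "norm (f x) \<le> (2 * K / r) * nrm X x"
proof (cases "nrm X x = 0")
  case True
  then show ?thesis
    using x linear_nul [OF f] by (simp add: nrm_eq_0_iff)
next
  case False
  then have pos: "nrm X x > 0"
    using nrm_ge_0 [OF x] by linarith
  define t where "t = r / (2 * nrm X x)"
  have t: "t > 0" "t * nrm X x < r"
    using pos r by (auto simp: t_def)
  have "norm (f (of_real t \<cdot> x)) \<le> K"
    using K [of "of_real t \<cdot> x"] x t by (simp add: nrm_scale)
  then have "t * norm (f x) \<le> K"
    using t(1) by (simp add: is_linearD(2) [OF f x] norm_mult)
  then show ?thesis
    using pos r by (simp add: t_def field_simps)
qed

lemma continuous_imp_bounded:
  assumes f: "is_linear X scalars f"
    and cont: "continuous_map (norm_topology X) (norm_topology scalars) f"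
  shows "\<exists>B. \<forall>x\<in>C. norm (f x) \<le> B * nrm X x"
proof -
  have "continuous_map mtopology Met_TC.mtopology f"
    using cont by (simp add: norm_topology_scalars norm_topology_eq)
  then obtain U where U: "openin mtopology U" "nul \<in> U" "\<And>y. y \<in> U \<Longrightarrow> f y \<in> ball (f nul) 1"
    unfolding Met_TC.continuous_map_to_metric
    by (metis M.zero_closed mball_eq_ball topspace_mtopology zero_less_one)
  then obtain r where r: "r > 0" "mball nul r \<subseteq> U"
    by (meson openin_mtopology)
  have "norm (f x) \<le> 1" if x: "x \<in> C" "nrm X x < r" for x
  proof -
    have "ndist X nul x = nrm X x"
      using x by (subst commute) (simp add: ndist_def minus_eq_scale)
    then have "x \<in> mball nul r"
      using x by simp
    then show ?thesis
      using U(3) r(2) linear_nul [OF f] by fastforce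
  qed
  then show ?thesis
    using linear_bound_of_ball [OF f r(1)] by blast
qed

lemma bounded_imp_continuous:
  assumes f: "is_linear X scalars f" and B: "\<And>x. x \<in> C \<Longrightarrow> norm (f x) \<le> B * nrm X x"
  shows "continuous_map (norm_topology X) (norm_topology scalars) f"
proof -
  have "\<exists>U. openin mtopology U \<and> x \<in> U \<and> (\<forall>y\<in>U. f y \<in> ball (f x) e)"
    if x: "x \<in> C" and e: "e > 0" for x e
  proof (intro exI conjI ballI)
    \<comment> \<open>Using \<open>\<bar>B\<bar> + 1\<close> keeps the radius positive for every
      \<open>B\<close>.\<close>
    let ?r = "e / (\<bar>B\<bar> + 1)"
    show "openin mtopology (mball x ?r)"
      by (rule openin_mball)
    show "x \<in> mball x ?r"
      using x e by (simp add: add_nonneg_pos)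
    fix y
    assume "y \<in> mball x ?r"
    then have y: "y \<in> C" "nrm X (x \<^bold>- y) < ?r"
      using x by (auto simp: ndist_eq)
    have "norm (f x - f y) \<le> B * nrm X (x \<^bold>- y)"
      using B [of "x \<^bold>- y"] x y by (simp add: linear_minus [OF f])
    also have "\<dots> \<le> (\<bar>B\<bar> + 1) * nrm X (x \<^bold>- y)"
      using x y by (intro mult_right_mono) auto
    also have "\<dots> < e"
      using y(2) by (simp add: field_simps add_nonneg_pos)
    finally show "f y \<in> ball (f x) e"
      by (simp add: dist_norm)
  qed
  then have "continuous_map mtopology Met_TC.mtopology f"
    unfolding Met_TC.continuous_map_to_metric by simp
  then show ?thesis
    by (simp add: norm_topology_scalars norm_topology_eq)
qed

section \<open>The dual as a normed space\<close>

lemma dual_iff: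
  "f \<in> carrier (dual X) \<longleftrightarrow>
     f \<in> extensional C \<and> is_linear X scalars f \<and> (\<exists>B. \<forall>x\<in>C. norm (f x) \<le> B * nrm X x)"
  using continuous_imp_bounded [of f] bounded_imp_continuous [of f]
  by (simp add: dual_def) blast

lemma dual_simps [simp]:
  "\<zero>\<^bsub>dual X\<^esub> = (\<lambda>x\<in>C. 0)"
  "f \<oplus>\<^bsub>dual X\<^esub> g = (\<lambda>x\<in>C. f x + g x)"
  "c \<odot>\<^bsub>dual X\<^esub> f = (\<lambda>x\<in>C. c * f x)"
  by (simp_all add: dual_def)

lemma is_linear_restrict: "is_linear X scalars (restrict f C) \<longleftrightarrow> is_linear X scalars f"
  by (simp add: is_linear_def Pi_iff)

lemma restrict_in_dual:
  assumes "is_linear X scalars f" "\<And>x. x \<in> C \<Longrightarrow> norm (f x) \<le> B * nrm X x"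
  shows "restrict f C \<in> carrier (dual X)"
  using assms unfolding dual_iff is_linear_restrict by auto

lemma dualD:
  assumes "f \<in> carrier (dual X)"
  shows "is_linear X scalars f" "f \<in> extensional C"
  using assms by (simp_all add: dual_iff)

text \<open>The dual norm is a conditionally complete supremum, so this bound is what makes it
  usable.\<close>

lemma dual_bdd:
  assumes "f \<in> carrier (dual X)"
  shows "bdd_above ((\<lambda>x. norm (f x)) ` {x \<in> C. nrm X x \<le> 1})"
proof -
  obtain B where B: "\<And>x. x \<in> C \<Longrightarrow> norm (f x) \<le> B * nrm X x"
    using assms by (auto simp: dual_iff)
  have "norm (f x) \<le> \<bar>B\<bar>" if "x \<in> C" "nrm X x \<le> 1" for x
  proof -
    have "norm (f x) \<le> \<bar>B\<bar> * nrm X x"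
      using B that by (meson abs_ge_self mult_right_mono nrm_ge_0 order_trans)
    also have "\<dots> \<le> \<bar>B\<bar> * 1"
      using that by (intro mult_left_mono) auto
    finally show ?thesis
      by simp
  qed
  then show ?thesis
    by (intro bdd_aboveI2) auto
qed

lemma nrm_dual: "nrm (dual X) f = (SUP x\<in>{x \<in> C. nrm X x \<le> 1}. norm (f x))"
  by (simp add: dual_def)

lemma norm_le_nrm_dual:
  assumes f: "f \<in> carrier (dual X)" and x: "x \<in> C"
  shows "norm (f x) \<le> nrm (dual X) f * nrm X x"
proof (cases "nrm X x = 0")
  case True
  then show ?thesis
    using x linear_nul [OF dualD(1) [OF f]] by (simp add: nrm_eq_0_iff)
next
  case False
  then have pos: "nrm X x > 0"
    using nrm_ge_0 [OF x] by linarith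
  let ?t = "1 / nrm X x"
  have "norm (f (of_real ?t \<cdot> x)) \<le> nrm (dual X) f"
    unfolding nrm_dual using x pos by (intro cSUP_upper dual_bdd f) (auto simp: nrm_scale norm_divide)
  then have "norm (f x) / nrm X x \<le> nrm (dual X) f"
    using pos by (simp add: is_linearD(2) [OF dualD(1) [OF f] x] norm_mult norm_divide)
  then show ?thesis
    using pos by (simp add: field_simps)
qed

lemma nrm_dual_le:
  assumes "0 \<le> B" "\<And>x. x \<in> C \<Longrightarrow> norm (f x) \<le> B * nrm X x"
  shows "nrm (dual X) f \<le> B"
  unfolding nrm_dual
proof (rule cSUP_least)
  show "{x \<in> C. nrm X x \<le> 1} \<noteq> {}"
    using nrm_nul by force
  fix x
  assume "x \<in> {x \<in> C. nrm X x \<le> 1}"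
  then show "norm (f x) \<le> B"
    using assms(2) [of x] mult_left_mono [of "nrm X x" 1 B] assms(1) by auto
qed

lemma nrm_dual_ge_0:
  assumes "f \<in> carrier (dual X)"
  shows "0 \<le> nrm (dual X) f"
  unfolding nrm_dual
  by (rule cSUP_upper2 [OF dual_bdd [OF assms], of nul]) auto

text \<open>The supremum need not be attained, but half of a positive supremum is exceeded
  somewhere.\<close>

lemma dual_norming:
  assumes f: "f \<in> carrier (dual X)"
  obtains x where "x \<in> C" "nrm X x \<le> 1" "nrm (dual X) f \<le> 2 * norm (f x)"
proof (cases "nrm (dual X) f = 0")
  case True
  then show ?thesis
    using that [of nul] by simp
next
  case False
  then have "nrm (dual X) f / 2 < nrm (dual X) f"
    using nrm_dual_ge_0 [OF f] by linarith
  moreover have "{x \<in> C. nrm X x \<le> 1} \<noteq> {}"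
    using nrm_nul by force
  ultimately obtain x where "x \<in> C" "nrm X x \<le> 1" "nrm (dual X) f / 2 < norm (f x)"
    using less_cSUP_iff [OF _ dual_bdd [OF f], of "nrm (dual X) f / 2"] unfolding nrm_dual by blast
  then show ?thesis
    using that [of x] by simp
qed

lemma dual_add_closed:
  assumes f: "f \<in> carrier (dual X)" and g: "g \<in> carrier (dual X)"
  shows "(\<lambda>x\<in>C. f x + g x) \<in> carrier (dual X)"
proof (rule restrict_in_dual)
  show "is_linear X scalars (\<lambda>x. f x + g x)"
    using dualD(1) [OF f] dualD(1) [OF g] by (simp add: is_linear_def algebra_simps)
  show "norm (f x + g x) \<le> (nrm (dual X) f + nrm (dual X) g) * nrm X x" if "x \<in> C" for x
    using norm_le_nrm_dual [OF f that] norm_le_nrm_dual [OF g that]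
    by (simp add: distrib_right norm_triangle_le)
qed

lemma dual_scale_closed:
  assumes f: "f \<in> carrier (dual X)"
  shows "(\<lambda>x\<in>C. c * f x) \<in> carrier (dual X)"
proof (rule restrict_in_dual)
  show "is_linear X scalars (\<lambda>x. c * f x)"
    using dualD(1) [OF f] by (simp add: is_linear_def algebra_simps)
  show "norm (c * f x) \<le> (norm c * nrm (dual X) f) * nrm X x" if "x \<in> C" for x
    using norm_le_nrm_dual [OF f that] by (simp add: norm_mult mult.assoc mult_left_mono)
qed

lemma dual_zero_closed: "(\<lambda>x\<in>C. 0) \<in> carrier (dual X)"
  by (rule restrict_in_dual [where B = 0]) (simp_all add: is_linear_def)

lemma dual_eqI:
  assumes "f \<in> carrier (dual X)" "g \<in> carrier (dual X)" "\<And>x. x \<in> C \<Longrightarrow> f x = g x"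
  shows "f = g"
  using assms dualD(2) by (meson extensionalityI)

lemma abelian_group_dual: "abelian_group (dual X)"
proof (rule abelian_groupI)
  fix f
  assume f: "f \<in> carrier (dual X)"
  show "\<exists>g\<in>carrier (dual X). g \<oplus>\<^bsub>dual X\<^esub> f = \<zero>\<^bsub>dual X\<^esub>"
    using dual_scale_closed [OF f, of "- 1"] by (intro bexI [of _ "\<lambda>x\<in>C. - 1 * f x"]) auto
  show "\<zero>\<^bsub>dual X\<^esub> \<oplus>\<^bsub>dual X\<^esub> f = f"
    using f dual_add_closed [OF dual_zero_closed f] by (intro dual_eqI) auto
qed (auto intro: dual_add_closed dual_zero_closed simp: algebra_simps fun_eq_iff)

lemma nspace_dual: "nspace (dual X)"
  unfolding nspace_iff is_normed_space_def
proof (intro conjI ballI allI)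
  show "Module.module scalars (dual X)"
  proof (rule moduleI)
    show "\<one>\<^bsub>scalars\<^esub> \<odot>\<^bsub>dual X\<^esub> f = f" if "f \<in> carrier (dual X)" for f
      using that dual_scale_closed [OF that, of 1] by (intro dual_eqI) auto
  qed (auto intro: cring_scalars abelian_group_dual dual_scale_closed simp: algebra_simps fun_eq_iff)
next
  fix f
  assume f: "f \<in> carrier (dual X)"
  show "0 \<le> nrm (dual X) f"
    using nrm_dual_ge_0 [OF f] .
  show "nrm (dual X) f = 0 \<longleftrightarrow> f = \<zero>\<^bsub>dual X\<^esub>"
  proof
    assume 0: "nrm (dual X) f = 0"
    show "f = \<zero>\<^bsub>dual X\<^esub>"
      using norm_le_nrm_dual [OF f] dual_zero_closed f by (intro dual_eqI) (auto simp: 0)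
  next
    assume "f = \<zero>\<^bsub>dual X\<^esub>"
    then have "nrm (dual X) f \<le> 0"
      by (intro nrm_dual_le) auto
    then show "nrm (dual X) f = 0"
      using nrm_dual_ge_0 [OF f] by simp
  qed
  \<comment> \<open>Only this inequality is proved directly; the converse follows by applying it to
    \<open>inverse c\<close>.\<close>
  have scale_le: "nrm (dual X) (c \<odot>\<^bsub>dual X\<^esub> g) \<le> norm c * nrm (dual X) g"
    if g: "g \<in> carrier (dual X)" for c g
    using norm_le_nrm_dual [OF g] nrm_dual_ge_0 [OF g]
    by (intro nrm_dual_le) (auto simp: norm_mult mult.assoc mult_left_mono)
  show "nrm (dual X) (c \<odot>\<^bsub>dual X\<^esub> f) = norm c * nrm (dual X) f" for c
  proof (cases "c = 0")
    case True
    then show ?thesis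
      using scale_le [OF f, of c] nrm_dual_ge_0 [OF dual_scale_closed [OF f, of c]] by simp
  next
    case False
    have "inverse c \<odot>\<^bsub>dual X\<^esub> (c \<odot>\<^bsub>dual X\<^esub> f) = f"
      using f False dual_scale_closed [OF dual_scale_closed [OF f, of c], of "inverse c"]
      by (intro dual_eqI) (auto simp flip: mult.assoc)
    then have "nrm (dual X) f \<le> norm (inverse c) * nrm (dual X) (c \<odot>\<^bsub>dual X\<^esub> f)"
      using scale_le [of "c \<odot>\<^bsub>dual X\<^esub> f" "inverse c"] dual_scale_closed [OF f, of c] by simp
    then have "norm c * nrm (dual X) f \<le> nrm (dual X) (c \<odot>\<^bsub>dual X\<^esub> f)"
      using False by (simp add: norm_inverse norm_divide field_simps)
    then show ?thesis
      using scale_le [OF f, of c] by (rule order_antisym [rotated])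
  qed
  show "nrm (dual X) (f \<oplus>\<^bsub>dual X\<^esub> g) \<le> nrm (dual X) f + nrm (dual X) g"
    if g: "g \<in> carrier (dual X)" for g
  proof (rule nrm_dual_le)
    show "0 \<le> nrm (dual X) f + nrm (dual X) g"
      using nrm_dual_ge_0 [OF f] nrm_dual_ge_0 [OF g] by simp
    show "norm ((f \<oplus>\<^bsub>dual X\<^esub> g) x) \<le> (nrm (dual X) f + nrm (dual X) g) * nrm X x"
      if x: "x \<in> C" for x
      using norm_le_nrm_dual [OF f x] norm_le_nrm_dual [OF g x] x
      by (simp add: distrib_right norm_triangle_le)
  qed
qed

text \<open>Domination of \<open>p\<close> by a multiple of the norm makes the functional bounded.
  This is applied to the norm, to the distance from a span and to an oscillation.\<close>

lemma Hahn_Banach_dual: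
  assumes p: "seminorm X p" and B: "\<And>x. x \<in> C \<Longrightarrow> p x \<le> B * nrm X x" and x0: "x0 \<in> C"
  obtains g where "g \<in> carrier (dual X)" "\<And>x. x \<in> C \<Longrightarrow> norm (g x) \<le> p x"
    "p x0 \<le> 2 * norm (g x0)"
proof -
  obtain g where g: "is_linear X scalars g" "\<And>x. x \<in> C \<Longrightarrow> norm (g x) \<le> p x"
    "p x0 \<le> 2 * norm (g x0)"
    using Hahn_Banach [OF p x0] by blast
  then have "restrict g C \<in> carrier (dual X)"
    using B by (intro restrict_in_dual [where B = B]) (auto intro: order_trans)
  then show ?thesis
    using that [of "restrict g C"] g x0 by simp
qed

lemma seminorm_nrm: "seminorm X (nrm X)"
  by (simp add: seminorm_def nrm_triangle nrm_scale)

lemma canonical_embedding_in_bidual: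
  assumes x: "x \<in> C"
  shows "canonical_embedding X x \<in> carrier (dual (dual X))"
proof -
  interpret D: nspace "dual X"
    by (rule nspace_dual)
  show ?thesis
    unfolding canonical_embedding_def
  proof (rule D.restrict_in_dual)
    show "is_linear (dual X) scalars (\<lambda>f. f x)"
      using x by (simp add: is_linear_def)
    show "norm (f x) \<le> nrm X x * nrm (dual X) f" if "f \<in> carrier (dual X)" for f
      using norm_le_nrm_dual [OF that x] by (simp add: mult.commute)
  qed
qed

end

section \<open>Uniform boundedness\<close>

text \<open>By Baire's theorem one of the closed sets \<open>A n\<close>, on which all
  \<open>g j\<close> are bounded by \<open>n\<close>, contains a ball. Translating the ball to the
  origin doubles the bound.\<close>

lemma (in nspace) uniform_boundedness:
  assumes mcomplete and g: "\<And>j::nat. g j \<in> carrier (dual X)"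
    and pw: "\<And>x. x \<in> C \<Longrightarrow> \<exists>B. \<forall>j. norm (g j x) \<le> B"
  obtains M where "\<And>j x. x \<in> C \<Longrightarrow> norm (g j x) \<le> M * nrm X x"
proof -
  define A where "A n = (\<Inter>j. {x \<in> C. g j x \<in> cball 0 (real n)})" for n
  have A_closed: "closedin mtopology (A n)" for n
    unfolding A_def
  proof (rule closedin_Inter)
    fix S
    assume "S \<in> range (\<lambda>j. {x \<in> C. g j x \<in> cball 0 (real n)})"
    then obtain j where S: "S = {x \<in> topspace mtopology. g j x \<in> cball 0 (real n)}"
      by auto
    have "continuous_map mtopology euclidean (g j)"
      using g [of j] by (simp add: dual_def norm_topology_scalars norm_topology_eq)
    then show "closedin mtopology S"
      unfolding S by (rule closedin_continuous_map_preimage) simp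
  qed simp
  have "C \<subseteq> (\<Union>n. A n)"
  proof
    fix x
    assume x: "x \<in> C"
    then obtain B where B: "\<And>j. norm (g j x) \<le> B"
      using pw by blast
    obtain n where "B \<le> real n"
      using real_arch_simple by blast
    then have "x \<in> A n"
      using B x by (auto simp: A_def intro: order_trans)
    then show "x \<in> (\<Union>n. A n)"
      by blast
  qed
  moreover have "A n \<subseteq> C" for n
    by (auto simp: A_def)
  ultimately have "(\<Union>n. A n) = topspace mtopology"
    by auto
  then have "mtopology interior_of (\<Union>n. A n) \<noteq> {}"
    using M.zero_closed by (metis empty_iff interior_of_topspace topspace_mtopology)
  then obtain n where "mtopology interior_of (A n) \<noteq> {}"
    using metric_Baire_category_alt [OF \<open>mcomplete\<close>, of "range A"] A_closed by auto
  then obtain x0 where "x0 \<in> mtopology interior_of (A n)"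
    by blast
  then obtain r where r: "r > 0" "mball x0 r \<subseteq> A n"
    using openin_interior_of [of mtopology "A n"] interior_of_subset [of mtopology "A n"]
    unfolding openin_mtopology by (meson order_trans)
  have x0: "x0 \<in> C"
    using \<open>x0 \<in> mtopology interior_of (A n)\<close> interior_of_subset [of mtopology "A n"] \<open>A n \<subseteq> C\<close>
    by blast
  have "norm (g j x) \<le> 2 * real n" if x: "x \<in> C" "nrm X x < r" for j x
  proof -
    have "ndist X x0 (x0 \<^bold>+ x) = nrm X x"
      using x x0 by (subst commute) (simp add: ndist_def M.minus_eq M.add.m_comm M.r_neg1)
    then have "x0 \<^bold>+ x \<in> A n" "x0 \<in> A n"
      using r x x0 by auto
    then have "norm (g j (x0 \<^bold>+ x)) \<le> n" "norm (g j x0) \<le> n"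
      by (auto simp: A_def)
    moreover have "g j x = g j (x0 \<^bold>+ x) - g j x0"
      using is_linearD(1) [OF dualD(1) [OF g] x0 x(1)] by simp
    ultimately show ?thesis
      using norm_triangle_ineq4 [of "g j (x0 \<^bold>+ x)" "g j x0"] by simp
  qed
  then show ?thesis
    using that linear_bound_of_ball [OF dualD(1) [OF g] r(1)] by blast
qed

text \<open>Split \<open>g j (y j)\<close> into \<open>g j (y j - y0) + g j y0\<close>. Uniform
  boundedness sends the first term to zero; evaluation at \<open>y0\<close> is in the bidual, so the
  second tends to \<open>f y0\<close>.\<close>

lemma (in nspace) tendsto_dual_pairing:
  assumes mcomplete and g: "weakly_converges (dual X) g f" and y: "limitin mtopology y y0 sequentially"
    and yC: "\<And>j. y j \<in> C"
  shows "(\<lambda>j. g j (y j)) \<longlonglongrightarrow> f y0"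
proof -
  have y0: "y0 \<in> C"
    using y by (simp add: limitin_metric)
  have gd: "g j \<in> carrier (dual X)" and fd: "f \<in> carrier (dual X)" for j
    using g by (auto simp: weakly_converges_def)
  have lim: "(\<lambda>j. g j x) \<longlonglongrightarrow> f x" if "x \<in> C" for x
    using g canonical_embedding_in_bidual [OF that] gd fd
    by (auto simp: weakly_converges_def canonical_embedding_def dest!: bspec)
  have "\<exists>B. \<forall>j. norm (g j x) \<le> B" if "x \<in> C" for x
    using convergent_imp_Bseq [OF convergentI [OF lim [OF that]]] by (auto simp: Bseq_def)
  then obtain M where M: "\<And>j x. x \<in> C \<Longrightarrow> norm (g j x) \<le> M * nrm X x"
    using uniform_boundedness [of g, OF \<open>mcomplete\<close> gd] by blast
  have "(\<lambda>j. nrm X (y j \<^bold>- y0)) \<longlonglongrightarrow> 0"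
    using y yC y0 by (simp add: limitin_metric_dist_null ndist_eq)
  then have "(\<lambda>j. M * nrm X (y j \<^bold>- y0)) \<longlonglongrightarrow> 0"
    by (rule tendsto_mult_right_zero)
  then have "(\<lambda>j. g j (y j \<^bold>- y0)) \<longlonglongrightarrow> 0"
    by (rule Lim_null_comparison [rotated]) (use M yC y0 in auto)
  then have "(\<lambda>j. g j (y j \<^bold>- y0) + g j y0) \<longlonglongrightarrow> 0 + f y0"
    by (intro tendsto_add lim y0)
  then show ?thesis
    using linear_minus [OF dualD(1) [OF gd] yC y0] by simp
qed

section \<open>Weakly convergent subsequences in the dual of a reflexive space\<close>

context kmodule
begin

text \<open>Lists of coefficients and indices make addition a concatenation, and countability of the
  rational span is that of a set of lists.\<close>

definition lincomb :: "(nat \<Rightarrow> 'a) \<Rightarrow> ('k \<times> nat) list \<Rightarrow> 'a" where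
  "lincomb u cs = foldr (\<lambda>(c, k) v. c \<cdot> u k \<^bold>+ v) cs nul"

lemma lincomb_simps [simp]:
  "lincomb u [] = nul"
  "lincomb u ((c, k) # cs) = c \<cdot> u k \<^bold>+ lincomb u cs"
  by (simp_all add: lincomb_def)

lemma lincomb_closed [simp, intro]: "(\<And>k. u k \<in> C) \<Longrightarrow> lincomb u cs \<in> C"
  by (induction cs) auto

lemma lincomb_append: "(\<And>k. u k \<in> C) \<Longrightarrow> lincomb u (cs @ ds) = lincomb u cs \<^bold>+ lincomb u ds"
  by (induction cs) (auto simp: M.add.m_assoc)

lemma lincomb_scale:
  "(\<And>k. u k \<in> C) \<Longrightarrow> lincomb u (map (\<lambda>(d, k). (c * d, k)) cs) = c \<cdot> lincomb u cs"
  by (induction cs) (auto simp: scale_add_right scale_assoc)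

end

context nspace
begin

lemma lincomb_approx:
  assumes u: "\<And>k. u k \<in> C" and Q: "\<And>z e. 0 < e \<Longrightarrow> \<exists>q\<in>Q. norm (z - q) < e" and e: "0 < e"
  shows "\<exists>ds\<in>lists (Q \<times> UNIV). nrm X (lincomb u cs \<^bold>- lincomb u ds) < e"
  using e
proof (induction cs arbitrary: e)
  case Nil
  then show ?case
    by (intro bexI [of _ "[]"]) (simp_all add: minus_eq_scale)
next
  case (Cons ck cs)
  obtain c k where ck: "ck = (c, k)"
    by force
  obtain ds where ds: "ds \<in> lists (Q \<times> UNIV)" "nrm X (lincomb u cs \<^bold>- lincomb u ds) < e / 2"
    using Cons.IH [of "e / 2"] Cons.prems by auto
  \<comment> \<open>Adding 1 avoids a division by zero when \<open>u k\<close> has norm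
    zero.\<close>
  let ?d = "e / (2 * (1 + nrm X (u k)))"
  have pos: "1 + nrm X (u k) > 0"
    using nrm_ge_0 [OF u [of k]] by linarith
  then obtain q where q: "q \<in> Q" "norm (c - q) < ?d"
    using Q [of ?d c] Cons.prems by auto
  have "norm (c - q) * nrm X (u k) \<le> norm (c - q) * (1 + nrm X (u k))"
    by (intro mult_left_mono) auto
  also have "\<dots> < e / 2"
    using q(2) pos by (simp add: field_simps)
  finally have 1: "nrm X ((c - q) \<cdot> u k) < e / 2"
    by (simp add: nrm_scale u)
  have "lincomb u (ck # cs) \<^bold>- lincomb u ((q, k) # ds)
      = (c - q) \<cdot> u k \<^bold>+ (lincomb u cs \<^bold>- lincomb u ds)"
    using scale_add_left [OF u, of c "- q" k]
    by (simp add: ck u minus_eq_scale scale_add_right scale_assoc M.add.m_ac)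
  then have "nrm X (lincomb u (ck # cs) \<^bold>- lincomb u ((q, k) # ds)) < e"
    using nrm_triangle [of "(c - q) \<cdot> u k" "lincomb u cs \<^bold>- lincomb u ds"] 1 ds(2) u by simp
  then show ?case
    using q(1) ds(1) by (intro bexI [of _ "(q, k) # ds"]) auto
qed

text \<open>The distance from the linear span of the \<open>u k\<close>; on \<open>C\<close> it
  vanishes exactly on the closed span.\<close>

definition span_dist :: "(nat \<Rightarrow> 'a) \<Rightarrow> 'a \<Rightarrow> real" where
  "span_dist u x = (INF cs. nrm X (x \<^bold>- lincomb u cs))"

lemma span_dist_le:
  assumes "\<And>k. u k \<in> C" "x \<in> C"
  shows "span_dist u x \<le> nrm X (x \<^bold>- lincomb u cs)"
  unfolding span_dist_def by (rule cINF_lower) (use assms in \<open>auto intro!: bdd_belowI2 [of _ 0]\<close>)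

lemma seminorm_span_dist:
  assumes u: "\<And>k. u k \<in> C"
  shows "seminorm X (span_dist u)"
proof -
  let ?d = "span_dist u"
  have le: "?d x \<le> nrm X (x \<^bold>- lincomb u cs)" if "x \<in> C" for x cs
    using span_dist_le [of u x cs] u that by blast
  have ge: "b \<le> ?d x" if "\<And>cs. b \<le> nrm X (x \<^bold>- lincomb u cs)" for b x
    unfolding span_dist_def by (rule cINF_greatest) (use that in auto)
  have "?d (x \<^bold>+ y) \<le> ?d x + ?d y" if x: "x \<in> C" and y: "y \<in> C" for x y
  proof -
    have *: "?d (x \<^bold>+ y) \<le> nrm X (x \<^bold>- lincomb u cs) + nrm X (y \<^bold>- lincomb u ds)" for cs ds
    proof -
      have "(x \<^bold>+ y) \<^bold>- lincomb u (cs @ ds) = (x \<^bold>- lincomb u cs) \<^bold>+ (y \<^bold>- lincomb u ds)"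
        using x y u by (simp add: lincomb_append minus_eq_scale scale_add_right M.add.m_ac)
      then show ?thesis
        using le [of "x \<^bold>+ y" "cs @ ds"] x y u
          nrm_triangle [of "x \<^bold>- lincomb u cs" "y \<^bold>- lincomb u ds"] by simp
    qed
    have "?d (x \<^bold>+ y) - nrm X (x \<^bold>- lincomb u cs) \<le> ?d y" for cs
      using * by (intro ge) (simp add: algebra_simps)
    then have "?d (x \<^bold>+ y) - ?d y \<le> ?d x"
      by (intro ge) (simp add: algebra_simps)
    then show ?thesis
      by simp
  qed
  moreover have "?d (c \<cdot> x) \<le> norm c * ?d x" if x: "x \<in> C" for c x
  proof (cases "c = 0")
    case True
    then show ?thesis
      using le [of nul "[]"] x by (simp add: minus_eq_scale)
  next
    case False
    have "?d (c \<cdot> x) / norm c \<le> ?d x"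
    proof (rule ge)
      fix cs
      have "c \<cdot> x \<^bold>- lincomb u (map (\<lambda>(d, k). (c * d, k)) cs) = c \<cdot> (x \<^bold>- lincomb u cs)"
        using x u by (simp add: lincomb_scale minus_eq_scale scale_add_right scale_assoc)
      then have "?d (c \<cdot> x) \<le> norm c * nrm X (x \<^bold>- lincomb u cs)"
        using le [of "c \<cdot> x" "map (\<lambda>(d, k). (c * d, k)) cs"] x u by (simp add: nrm_scale)
      then show "?d (c \<cdot> x) / norm c \<le> nrm X (x \<^bold>- lincomb u cs)"
        using False by (simp add: field_simps)
    qed
    then show ?thesis
      using False by (simp add: field_simps)
  qed
  ultimately show "seminorm X ?d"
    by (simp add: seminorm_def)
qed

text \<open>A functional dominated by the distance from the span vanishes at every
  \<open>u k\<close>, hence at \<open>x\<close>; by Hahn-Banach that distance is zero at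
  \<open>x\<close>. Coefficients are then replaced by nearby ones from the countable set
  \<open>Q\<close>.\<close>

lemma countable_dense_in_biannihilator:
  assumes u: "\<And>k::nat. u k \<in> C"
  obtains D where "countable D" "D \<subseteq> C"
    "\<And>x e. \<lbrakk>x \<in> C; \<forall>f\<in>carrier (dual X). (\<forall>k. f (u k) = 0) \<longrightarrow> f x = 0; 0 < e\<rbrakk>
      \<Longrightarrow> \<exists>h\<in>D. nrm X (x \<^bold>- h) < e"
proof -
  obtain Q :: "'k set" where Q: "countable Q" "\<And>z e. 0 < e \<Longrightarrow> \<exists>q\<in>Q. norm (z - q) < e"
    by (rule countable_dense_scalars) blast
  let ?d = "span_dist u"
  have le: "?d x \<le> nrm X (x \<^bold>- lincomb u cs)" if "x \<in> C" for x cs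
    using span_dist_le [of u x cs] u that by blast
  have "\<exists>h\<in>lincomb u ` lists (Q \<times> UNIV). nrm X (x \<^bold>- h) < e"
    if x: "x \<in> C" and ann: "\<forall>f\<in>carrier (dual X). (\<forall>k. f (u k) = 0) \<longrightarrow> f x = 0" and e: "0 < e"
    for x e
  proof -
    have d_le: "?d y \<le> 1 * nrm X y" if "y \<in> C" for y
      using le [OF that, of "[]"] that by (simp add: minus_eq_scale)
    obtain f where f: "f \<in> carrier (dual X)" "\<And>y. y \<in> C \<Longrightarrow> norm (f y) \<le> ?d y" "?d x \<le> 2 * norm (f x)"
      using Hahn_Banach_dual [OF seminorm_span_dist [of u, OF u] d_le x] by blast
    have "?d (u k) \<le> 0" for k
      using le [OF u, of k "[(1, k)]"] u by (simp add: minus_eq_scale scale_minus_cancel)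
    then have "f (u k) = 0" for k
      using f(2) [OF u, of k] by (meson norm_le_zero_iff order_trans)
    then have "f x = 0"
      using ann f(1) by blast
    then have "?d x \<le> 0"
      using f(3) by simp
    moreover have "bdd_below (range (\<lambda>cs. nrm X (x \<^bold>- lincomb u cs)))"
      using x u by (auto intro!: bdd_belowI2 [of _ 0])
    ultimately obtain cs where cs: "nrm X (x \<^bold>- lincomb u cs) < e / 2"
      using cINF_less_iff [of UNIV "\<lambda>cs. nrm X (x \<^bold>- lincomb u cs)" "e / 2"] e
      by (auto simp: span_dist_def)
    obtain ds where ds: "ds \<in> lists (Q \<times> UNIV)" "nrm X (lincomb u cs \<^bold>- lincomb u ds) < e / 2"
      using lincomb_approx [of u Q "e / 2" cs, OF u Q(2)] e by auto
    have "nrm X (x \<^bold>- lincomb u ds) < e"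
      using triangle [of x "lincomb u cs" "lincomb u ds"] cs ds(2) x u by (simp add: ndist_eq)
    then show ?thesis
      using ds(1) by blast
  qed
  moreover have "countable (lincomb u ` lists (Q \<times> UNIV))"
    using Q(1) by (intro countable_image countable_lists) auto
  ultimately show ?thesis
    using u by (intro that [of "lincomb u ` lists (Q \<times> UNIV)"]) blast+
qed

text \<open>The limit of the oscillations over tails inherits subadditivity and homogeneity. Its
  zeros are the points satisfying the Cauchy condition, and the scalars are complete.\<close>

lemma oscillation_seminorm:
  assumes f: "\<And>k::nat. f k \<in> carrier (dual X)" and B: "\<And>k. nrm (dual X) (f k) \<le> B"
  obtains q where "seminorm X q" "\<And>x. x \<in> C \<Longrightarrow> q x \<le> 2 * B * nrm X x"
    "\<And>x. x \<in> C \<Longrightarrow> q x = 0 \<longleftrightarrow> convergent (\<lambda>k. f k x)"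
proof -
  define e where "e n x = (SUP (k, l)\<in>{n..} \<times> {n..}. norm (f k x - f l x))" for n x
  define q where "q x = (INF n. e n x)" for x
  have bound: "norm (f k x - f l x) \<le> 2 * B * nrm X x" if x: "x \<in> C" for k l x
  proof -
    have "norm (f j x) \<le> B * nrm X x" for j
      using norm_le_nrm_dual [OF f x, of j] B [of j] x by (meson mult_right_mono nrm_ge_0 order_trans)
    from this [of k] this [of l] show ?thesis
      using norm_triangle_ineq4 [of "f k x" "f l x"] by simp
  qed
  have le_e: "norm (f k x - f l x) \<le> e n x" if "x \<in> C" "n \<le> k" "n \<le> l" for k l n x
  proof -
    have "bdd_above ((\<lambda>(k, l). norm (f k x - f l x)) ` ({n..} \<times> {n..}))"
      using bound [OF that(1)] by (auto intro!: bdd_aboveI2)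
    then show ?thesis
      unfolding e_def using cSUP_upper [of "(k, l)" "{n..} \<times> {n..}" "\<lambda>(k, l). norm (f k x - f l x)"] that
      by auto
  qed
  have e_le: "e n x \<le> b" if "\<And>k l. \<lbrakk>n \<le> k; n \<le> l\<rbrakk> \<Longrightarrow> norm (f k x - f l x) \<le> b" for n x b
    unfolding e_def by (rule cSUP_least) (use that in auto)
  have e_ge_0: "0 \<le> e n x" if "x \<in> C" for n x
    using le_e [OF that, of n n n] by simp
  have bdd: "bdd_below (range (\<lambda>n. e n x))" if "x \<in> C" for x
    using e_ge_0 [OF that] by (auto intro!: bdd_belowI2)
  \<comment> \<open>As \<open>e n x\<close> decreases in \<open>n\<close>, the infimum is a limit,
    and inequalities between the \<open>e n\<close> pass to \<open>q\<close>.\<close>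
  have lim: "(\<lambda>n. e n x) \<longlonglongrightarrow> q x" if x: "x \<in> C" for x
    unfolding q_def
  proof (rule LIMSEQ_decseq_INF [OF bdd [OF x]])
    show "decseq (\<lambda>n. e n x)"
      unfolding decseq_def by (intro allI impI e_le le_e x) auto
  qed
  have q_le: "q x \<le> e n x" if "x \<in> C" for x n
    unfolding q_def using bdd [OF that] by (rule cINF_lower) simp
  have "q (x \<^bold>+ y) \<le> q x + q y" if x: "x \<in> C" and y: "y \<in> C" for x y
  proof (rule LIMSEQ_le [OF lim tendsto_add [OF lim lim]])
    have "e n (x \<^bold>+ y) \<le> e n x + e n y" for n
    proof (rule e_le)
      fix k l
      assume kl: "n \<le> k" "n \<le> l"
      have "f k (x \<^bold>+ y) - f l (x \<^bold>+ y) = (f k x - f l x) + (f k y - f l y)"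
        using is_linearD(1) [OF dualD(1) [OF f] x y] by simp
      then show "norm (f k (x \<^bold>+ y) - f l (x \<^bold>+ y)) \<le> e n x + e n y"
        using le_e [OF x kl] le_e [OF y kl] by (metis add_mono norm_triangle_le)
    qed
    then show "\<exists>N. \<forall>n\<ge>N. e n (x \<^bold>+ y) \<le> e n x + e n y"
      by blast
  qed (use x y in auto)
  moreover have "q (c \<cdot> x) \<le> norm c * q x" if x: "x \<in> C" for c x
  proof (rule LIMSEQ_le [OF lim tendsto_mult_left [OF lim]])
    have "e n (c \<cdot> x) \<le> norm c * e n x" for n
    proof (rule e_le)
      fix k l
      assume kl: "n \<le> k" "n \<le> l"
      have "f k (c \<cdot> x) - f l (c \<cdot> x) = c * (f k x - f l x)"
        using is_linearD(2) [OF dualD(1) [OF f] x] by (simp add: right_diff_distrib)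
      then show "norm (f k (c \<cdot> x) - f l (c \<cdot> x)) \<le> norm c * e n x"
        using le_e [OF x kl] by (simp add: norm_mult mult_left_mono)
    qed
    then show "\<exists>N. \<forall>n\<ge>N. e n (c \<cdot> x) \<le> norm c * e n x"
      by blast
  qed (use x in auto)
  ultimately have "seminorm X q"
    by (simp add: seminorm_def)
  moreover have "q x \<le> 2 * B * nrm X x" if x: "x \<in> C" for x
    using q_le [OF x, of 0] e_le [of 0 x] bound [OF x] by (meson order_trans)
  moreover have "q x = 0 \<longleftrightarrow> convergent (\<lambda>k. f k x)" if x: "x \<in> C" for x
  proof
    assume "q x = 0"
    have "Cauchy (\<lambda>k. f k x)"
    proof (rule CauchyI)
      fix r :: real
      assume "0 < r"
      then have "eventually (\<lambda>n. e n x < r) sequentially"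
        using lim [OF x] \<open>q x = 0\<close> by (auto dest: order_tendstoD(2))
      then obtain n where "e n x < r"
        by (auto simp: eventually_sequentially)
      then have "norm (f k x - f l x) < r" if "n \<le> k" "n \<le> l" for k l
        using le_e [OF x that] by simp
      then show "\<exists>n. \<forall>k\<ge>n. \<forall>l\<ge>n. norm (f k x - f l x) < r"
        by blast
    qed
    then show "convergent (\<lambda>k. f k x)"
      by (rule Cauchy_convergent)
  next
    assume "convergent (\<lambda>k. f k x)"
    then have "Cauchy (\<lambda>k. f k x)"
      by (rule convergent_Cauchy)
    have "q x \<le> r" if r: "0 < r" for r
    proof -
      obtain n where n: "\<And>k l. \<lbrakk>n \<le> k; n \<le> l\<rbrakk> \<Longrightarrow> norm (f k x - f l x) < r"
        using CauchyD [OF \<open>Cauchy (\<lambda>k. f k x)\<close> r] by blast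
      then have "e n x \<le> r"
        by (intro e_le) (auto intro: less_imp_le)
      then show ?thesis
        using q_le [OF x, of n] by simp
    qed
    then have "q x \<le> 0"
      using field_le_epsilon [of "q x" 0] by simp
    moreover have "0 \<le> q x"
      unfolding q_def using e_ge_0 [OF x] by (intro cINF_greatest) auto
    ultimately show "q x = 0"
      by simp
  qed
  ultimately show ?thesis
    using that [of q] by blast
qed

section \<open>Weak limits under reflexivity\<close>

lemma reflexive_bidualE:
  assumes "reflexive_space X" "h \<in> carrier (dual (dual X))"
  obtains z where "z \<in> C" "\<And>f. f \<in> carrier (dual X) \<Longrightarrow> h f = f z"
proof -
  obtain z where "z \<in> C" "h = canonical_embedding X z"
    using assms unfolding reflexive_space_def by blast
  then show ?thesis
    using that [of z] by (simp add: canonical_embedding_def)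
qed

text \<open>Under reflexivity every element of the bidual is an evaluation, so pointwise convergence
  to an element of the dual is weak convergence. The uniform bound passes to the limit.\<close>

lemma pointwise_limit_weakly_converges:
  assumes refl: "reflexive_space X"
    and f: "\<And>k. f k \<in> carrier (dual X)" and B: "\<And>k. nrm (dual X) (f k) \<le> B"
    and conv: "\<And>x. x \<in> C \<Longrightarrow> convergent (\<lambda>k. f k x)"
  obtains g where "weakly_converges (dual X) f g"
proof -
  define g where "g = (\<lambda>x\<in>C. lim (\<lambda>k. f k x))"
  have lim: "(\<lambda>k. f k x) \<longlonglongrightarrow> g x" if "x \<in> C" for x
    using conv [OF that] that by (simp add: g_def convergent_LIMSEQ_iff)
  have "is_linear X scalars g"
    unfolding is_linear_def
  proof (intro conjI ballI allI)
    show "g (x \<oplus>\<^bsub>X\<^esub> y) = g x \<oplus>\<^bsub>scalars\<^esub> g y" if "x \<in> C" "y \<in> C" for x y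
      using tendsto_add [OF lim lim, OF that] lim [of "x \<^bold>+ y"] that
        is_linearD(1) [OF dualD(1) [OF f]] by (simp add: LIMSEQ_unique)
    show "g (c \<odot>\<^bsub>X\<^esub> x) = c \<odot>\<^bsub>scalars\<^esub> g x" if "x \<in> C" for c x
      using tendsto_mult_left [OF lim, OF that, of c] lim [of "c \<cdot> x"] that
        is_linearD(2) [OF dualD(1) [OF f]] by (simp add: LIMSEQ_unique)
  qed auto
  moreover have "norm (g x) \<le> B * nrm X x" if x: "x \<in> C" for x
  proof (rule LIMSEQ_le_const2 [OF tendsto_norm [OF lim [OF x]]])
    have "norm (f k x) \<le> B * nrm X x" for k
      using norm_le_nrm_dual [OF f x, of k] B [of k] x by (meson mult_right_mono nrm_ge_0 order_trans)
    then show "\<exists>N. \<forall>k\<ge>N. norm (f k x) \<le> B * nrm X x"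
      by blast
  qed
  ultimately have g: "g \<in> carrier (dual X)"
    unfolding dual_iff by (auto simp: g_def)
  have "(\<lambda>k. h (f k)) \<longlonglongrightarrow> h g" if h: "h \<in> carrier (dual (dual X))" for h
  proof -
    obtain z where "z \<in> C" "\<And>f. f \<in> carrier (dual X) \<Longrightarrow> h f = f z"
      using reflexive_bidualE [OF refl h] by blast
    then show ?thesis
      using lim f g by simp
  qed
  then show ?thesis
    using that [of g] f g by (simp add: weakly_converges_def)
qed

lemma bounded_dual_weakly_convergent_subsequence:
  assumes refl: "reflexive_space X"
    and f: "\<And>k::nat. f k \<in> carrier (dual X)" and B: "\<And>k. nrm (dual X) (f k) \<le> B"
  obtains r g where "strict_mono r" "weakly_converges (dual X) (f \<circ> r) g"
proof -
  interpret D: nspace "dual X"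
    by (rule nspace_dual)
  \<comment> \<open>The density lemma is applied with \<open>dual X\<close> as the space and the
    \<open>f k\<close> as the vectors.\<close>
  obtain D where D: "countable D" "D \<subseteq> carrier (dual X)"
    and dense: "\<And>g e. \<lbrakk>g \<in> carrier (dual X);
      \<forall>h\<in>carrier (dual (dual X)). (\<forall>k. h (f k) = 0) \<longrightarrow> h g = 0; 0 < e\<rbrakk>
      \<Longrightarrow> \<exists>h\<in>D. nrm (dual X) (g \<ominus>\<^bsub>dual X\<^esub> h) < e"
    by (rule D.countable_dense_in_biannihilator [of f, OF f]) blast
  have "\<forall>h\<in>D. \<exists>x. x \<in> C \<and> nrm X x \<le> 1 \<and> nrm (dual X) h \<le> 2 * norm (h x)"
    using dual_norming D(2) by blast
  from bchoice [OF this] obtain z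
    where z: "\<And>h. h \<in> D \<Longrightarrow> z h \<in> C \<and> nrm X (z h) \<le> 1 \<and> nrm (dual X) h \<le> 2 * norm (h (z h))"
    by blast
  have "norm (f k s) \<le> B" if "s \<in> z ` D" for k s
  proof -
    have s: "s \<in> C" "nrm X s \<le> 1"
      using that z by auto
    have "norm (f k s) \<le> nrm (dual X) (f k) * nrm X s"
      by (rule norm_le_nrm_dual [OF f s(1)])
    also have "\<dots> \<le> nrm (dual X) (f k) * 1"
      using s nrm_dual_ge_0 [OF f] by (intro mult_left_mono)
    finally show ?thesis
      using B [of k] by simp
  qed
  \<comment> \<open>Diagonal subsequence, converging at every point of the norming set.\<close>
  then obtain r where r: "strict_mono r" and r_conv: "\<And>s. s \<in> z ` D \<Longrightarrow> \<exists>l. (\<lambda>k. f (r k) s) \<longlonglongrightarrow> l"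
    using function_convergent_subsequence [OF countable_image [OF D(1)]] by metis
  obtain q where q: "seminorm X q" "\<And>x. x \<in> C \<Longrightarrow> q x \<le> 2 * B * nrm X x"
    "\<And>x. x \<in> C \<Longrightarrow> q x = 0 \<longleftrightarrow> convergent (\<lambda>k. f (r k) x)"
    by (rule oscillation_seminorm [of "\<lambda>k. f (r k)" B]) (use f B in auto)
  have "convergent (\<lambda>k. f (r k) x)" if x: "x \<in> C" for x
  proof -
    obtain g where g: "g \<in> carrier (dual X)" "\<And>y. y \<in> C \<Longrightarrow> norm (g y) \<le> q y" "q x \<le> 2 * norm (g x)"
      using Hahn_Banach_dual [OF q(1,2) x] by blast
    have g0: "g y = 0" if "y \<in> C" "convergent (\<lambda>k. f (r k) y)" for y
      using g(2) [OF that(1)] q(3) [OF that(1)] that(2) by simp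
    \<comment> \<open>Here \<open>h\<close> is evaluation at some \<open>y\<close> where all
      \<open>f k\<close> vanish; the sequence converges there trivially, so
      \<open>g y = 0\<close>.\<close>
    have ann: "h g = 0" if h: "h \<in> carrier (dual (dual X))" "\<And>k. h (f k) = 0" for h
    proof -
      obtain y where y: "y \<in> C" "\<And>f. f \<in> carrier (dual X) \<Longrightarrow> h f = f y"
        using reflexive_bidualE [OF refl h(1)] by blast
      then have "f (r k) y = 0" for k
        using h(2) [of "r k"] f by simp
      then show ?thesis
        using g0 [OF y(1)] y(2) [OF g(1)] by (simp add: convergent_const)
    qed
    \<comment> \<open>Since \<open>g (z h) = 0\<close>, the norm of \<open>h\<close> is at most
      twice that of \<open>g - h\<close>, and the norm of \<open>g\<close> at most three times;
      hence \<open>e / 3\<close>.\<close>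
    have "nrm (dual X) g \<le> 0 + e" if "0 < e" for e
    proof -
      have "\<exists>h\<in>D. nrm (dual X) (g \<ominus>\<^bsub>dual X\<^esub> h) < e / 3"
        by (rule dense [OF g(1)]) (use ann that in auto)
      then obtain h where h: "h \<in> D" "nrm (dual X) (g \<ominus>\<^bsub>dual X\<^esub> h) < e / 3"
        by blast
      have hd: "h \<in> carrier (dual X)"
        using h(1) D(2) by blast
      have gh: "g \<ominus>\<^bsub>dual X\<^esub> h \<in> carrier (dual X)"
        using g(1) hd by (rule D.M.minus_closed)
      have zh: "z h \<in> C" "nrm X (z h) \<le> 1" "nrm (dual X) h \<le> 2 * norm (h (z h))"
        using z [OF h(1)] by auto
      have "convergent (\<lambda>k. f (r k) (z h))"
        using r_conv [of "z h"] h(1) by (auto simp: convergent_def)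
      then have "g (z h) = 0"
        using g0 zh(1) by blast
      moreover have "(g \<ominus>\<^bsub>dual X\<^esub> h) (z h) = g (z h) - h (z h)"
        using zh(1) hd by (simp add: D.minus_eq_scale)
      ultimately have "norm (h (z h)) = norm ((g \<ominus>\<^bsub>dual X\<^esub> h) (z h))"
        by simp
      also have "\<dots> \<le> nrm (dual X) (g \<ominus>\<^bsub>dual X\<^esub> h) * nrm X (z h)"
        by (rule norm_le_nrm_dual [OF gh zh(1)])
      also have "\<dots> \<le> nrm (dual X) (g \<ominus>\<^bsub>dual X\<^esub> h) * 1"
        using zh(2) nrm_dual_ge_0 [OF gh] by (intro mult_left_mono)
      finally have "nrm (dual X) h \<le> 2 * nrm (dual X) (g \<ominus>\<^bsub>dual X\<^esub> h)"
        using zh(3) by simp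
      moreover have "nrm (dual X) g \<le> nrm (dual X) (g \<ominus>\<^bsub>dual X\<^esub> h) + nrm (dual X) h"
      proof -
        have "g = (g \<ominus>\<^bsub>dual X\<^esub> h) \<oplus>\<^bsub>dual X\<^esub> h"
          using g(1) hd by (simp only: D.M.minus_eq D.M.add.m_assoc D.M.a_inv_closed D.M.l_neg D.M.r_zero)
        then show ?thesis
          using D.nrm_triangle [OF gh hd] by simp
      qed
      ultimately show ?thesis
        using h(2) by simp
    qed
    then have "nrm (dual X) g \<le> 0"
      by (rule field_le_epsilon)
    then have "norm (g x) \<le> 0"
      using norm_le_nrm_dual [OF g(1) x] nrm_dual_ge_0 [OF g(1)] by simp
    then have "q x = 0"
      using g(3) seminormD(3) [OF q(1) x] by simp
    then show ?thesis
      using q(3) [OF x] by simp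
  qed
  then obtain g where "weakly_converges (dual X) (f \<circ> r) g"
    using pointwise_limit_weakly_converges [OF refl, of "f \<circ> r" B] f B by auto
  then show ?thesis
    using that r by blast
qed

text \<open>The pairing is assumed along all subsequences of \<open>y\<close>, because functionals
  are chosen only where \<open>y\<close> stays away from \<open>y0\<close> and then thinned out to
  converge weakly.\<close>

lemma limitin_of_dual_pairing:
  assumes refl: "reflexive_space X" and y: "\<And>j. y j \<in> C" and y0: "y0 \<in> C"
    and pair: "\<And>r g f. \<lbrakk>strict_mono r; weakly_converges (dual X) g f\<rbrakk>
      \<Longrightarrow> (\<lambda>j. g j (y (r j))) \<longlonglongrightarrow> f y0"
  shows "limitin mtopology y y0 sequentially"
proof (rule ccontr)
  assume "\<not> ?thesis"
  then obtain e where e: "0 < e" "\<not> eventually (\<lambda>j. nrm X (y j \<^bold>- y0) < e) sequentially"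
    using y y0 by (auto simp: limitin_metric ndist_eq)
  obtain r where r: "strict_mono (r :: nat \<Rightarrow> nat)" "\<And>j. e \<le> nrm X (y (r j) \<^bold>- y0)"
    using not_eventually_sequentiallyD [OF e(2)] by (auto simp: not_less)
  have "\<exists>g\<in>carrier (dual X). nrm (dual X) g \<le> 1 \<and> e \<le> 2 * norm (g (y (r j) \<^bold>- y0))" for j
  proof -
    obtain g where g: "g \<in> carrier (dual X)" "\<And>x. x \<in> C \<Longrightarrow> norm (g x) \<le> nrm X x"
      "nrm X (y (r j) \<^bold>- y0) \<le> 2 * norm (g (y (r j) \<^bold>- y0))"
      by (rule Hahn_Banach_dual [OF seminorm_nrm, of 1 "y (r j) \<^bold>- y0"]) (use y y0 in auto)
    then show ?thesis
      using r(2) [of j] nrm_dual_le [of 1 g] by (intro bexI [of _ g]) auto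
  qed
  then have "\<forall>j. \<exists>g. g \<in> carrier (dual X) \<and> nrm (dual X) g \<le> 1 \<and> e \<le> 2 * norm (g (y (r j) \<^bold>- y0))"
    by blast
  from choice [OF this] obtain g where g: "\<And>j. g j \<in> carrier (dual X)" "\<And>j. nrm (dual X) (g j) \<le> 1"
    "\<And>j. e \<le> 2 * norm (g j (y (r j) \<^bold>- y0))"
    by blast
  obtain s f where s: "strict_mono s" "weakly_converges (dual X) (g \<circ> s) f"
    using bounded_dual_weakly_convergent_subsequence [OF refl, of g 1] g(1,2) by blast
  have "(\<lambda>j. (g \<circ> s) j (y ((r \<circ> s) j))) \<longlonglongrightarrow> f y0"
    using pair [OF strict_mono_o [OF r(1) s(1)] s(2)] .
  moreover have "(\<lambda>j. (g \<circ> s) j y0) \<longlonglongrightarrow> f y0"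
    using s(2) canonical_embedding_in_bidual [OF y0]
    by (auto simp: weakly_converges_def canonical_embedding_def dest!: bspec)
  \<comment> \<open>Both pairings have the limit \<open>f y0\<close>, so their difference tends to
    zero although its norm is at least \<open>e / 2\<close>.\<close>
  ultimately have "(\<lambda>j. (g \<circ> s) j (y ((r \<circ> s) j)) - (g \<circ> s) j y0) \<longlonglongrightarrow> f y0 - f y0"
    by (rule tendsto_diff)
  then have "(\<lambda>j. norm (g (s j) (y (r (s j)) \<^bold>- y0))) \<longlonglongrightarrow> 0"
    using linear_minus [OF dualD(1) [OF g(1)] y y0] by (simp add: tendsto_norm_zero_iff)
  moreover have "e / 2 \<le> norm (g (s j) (y (r (s j)) \<^bold>- y0))" for j
    using g(3) [of "s j"] by simp
  ultimately have "e / 2 \<le> 0"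
    by (meson LIMSEQ_le_const)
  then show False
    using e(1) by simp
qed

end

section \<open>Multilinear operators\<close>

lemma weakly_converges_subseq:
  assumes "weakly_converges X x a" "strict_mono r"
  shows "weakly_converges X (x \<circ> r) a"
  unfolding weakly_converges_def
proof (intro conjI ballI allI)
  fix f
  assume "f \<in> carrier (dual X)"
  then have "(\<lambda>j. f (x j)) \<longlonglongrightarrow> f a"
    using assms(1) by (auto simp: weakly_converges_def)
  then show "(\<lambda>j. f ((x \<circ> r) j)) \<longlonglongrightarrow> f a"
    using LIMSEQ_subseq_LIMSEQ [OF _ assms(2)] by (simp add: o_def)
qed (use assms(1) in \<open>auto simp: weakly_converges_def\<close>)

lemma topspace_norm_topology:
  assumes "is_banach_space X"
  shows "topspace (norm_topology X) = carrier X"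
proof -
  interpret nspace X
    using assms by (simp add: nspace_iff is_banach_space_def)
  show ?thesis
    by (simp add: norm_topology_eq)
qed

text \<open>Continuity includes mapping the product of the carriers into the carrier of
  \<open>F\<close>.\<close>

lemma multilinear_ops_closed:
  assumes "T \<in> multilinear_ops m E F" "\<And>i. i \<in> {1..m} \<Longrightarrow> is_banach_space (E i)"
    "is_banach_space F" "x \<in> tuples m E"
  shows "T x \<in> carrier F"
proof -
  have "x \<in> topspace (product_topology (\<lambda>i. norm_topology (E i)) {1..m})"
    using assms(2,4) by (simp add: PiE_iff topspace_norm_topology)
  then show ?thesis
    using assms(1) topspace_norm_topology [OF assms(3)] unfolding multilinear_ops_def continuous_map_def by blast
qed

theorem theorem3p18:
  fixes E :: "nat \<Rightarrow> ('k::real_or_complex, 'a) normed_space"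
    and F :: "('k, 'b) normed_space"
    and m :: nat
  assumes "m \<ge> 1"
    and "\<And>i. i \<in> {1..m} \<Longrightarrow> is_banach_space (E i)"
    and "is_banach_space F"
    and "reflexive_space F"
  shows "L_DP_ev m E F = L_WDP_ev m E F"
proof -
  interpret F: nspace F
    using assms(3) by (simp add: nspace_iff is_banach_space_def)
  have complete: F.mcomplete
    using assms(3) by (simp add: is_banach_space_def)
  have closed: "T (\<lambda>i\<in>{1..m}. x i j) \<in> carrier F"
    if "T \<in> multilinear_ops m E F" "\<forall>i\<in>{1..m}. weakly_converges (E i) (x i) (a i)" for T x a j
    using that(2) by (intro multilinear_ops_closed [OF that(1) assms(2,3)]) (auto simp: weakly_converges_def)
  show ?thesis
  proof (intro equalityI subsetI)
    fix T
    assume T: "T \<in> L_DP_ev m E F"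
    then have Tm: "T \<in> multilinear_ops m E F"
      by (simp add: L_DP_ev_def)
    show "T \<in> L_WDP_ev m E F"
      unfolding L_WDP_ev_def
    proof (intro CollectI conjI Tm ballI allI impI; elim conjE)
      fix a x g f
      assume a: "a \<in> tuples m E" and x: "\<forall>i\<in>{1..m}. weakly_converges (E i) (x i) (a i)"
        and g: "weakly_converges (dual F) g f"
      have "limitin F.mtopology (\<lambda>j. T (\<lambda>i\<in>{1..m}. x i j)) (T a) sequentially"
        using T a x by (simp add: L_DP_ev_def F.norm_topology_eq)
      then show "(\<lambda>j. g j (T (\<lambda>i\<in>{1..m}. x i j))) \<longlonglongrightarrow> f (T a)"
        using closed [OF Tm x] by (rule F.tendsto_dual_pairing [OF complete g])
    qed
  next
    fix T
    assume T: "T \<in> L_WDP_ev m E F"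
    then have Tm: "T \<in> multilinear_ops m E F"
      by (simp add: L_WDP_ev_def)
    have wdp: "(\<lambda>j. g j (T (\<lambda>i\<in>{1..m}. x i j))) \<longlonglongrightarrow> f (T a)"
      if "a \<in> tuples m E" "\<forall>i\<in>{1..m}. weakly_converges (E i) (x i) (a i)"
        "weakly_converges (dual F) g f" for a x g f
      using T that unfolding L_WDP_ev_def by blast
    show "T \<in> L_DP_ev m E F"
      unfolding L_DP_ev_def F.norm_topology_eq
    proof (intro CollectI conjI Tm ballI allI impI)
      fix a x
      assume a: "a \<in> tuples m E" and x: "\<forall>i\<in>{1..m}. weakly_converges (E i) (x i) (a i)"
      show "limitin F.mtopology (\<lambda>j. T (\<lambda>i\<in>{1..m}. x i j)) (T a) sequentially"
      proof (rule F.limitin_of_dual_pairing [OF assms(4) closed [OF Tm x]])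
        show "T a \<in> carrier F"
          using multilinear_ops_closed [OF Tm assms(2,3) a] .
        fix r g f
        assume r: "strict_mono (r :: nat \<Rightarrow> nat)" and g: "weakly_converges (dual F) g f"
        \<comment> \<open>The same \<open>r\<close> is applied in every variable, so the thinned
          arguments still converge weakly and \<open>wdp\<close> covers the subsequence.\<close>
        have "\<forall>i\<in>{1..m}. weakly_converges (E i) (x i \<circ> r) (a i)"
          by (intro ballI weakly_converges_subseq r bspec [OF x])
        with wdp [OF a _ g, of "\<lambda>i. x i \<circ> r"]
        show "(\<lambda>j. g j (T (\<lambda>i\<in>{1..m}. x i (r j)))) \<longlonglongrightarrow> f (T a)"
          by (simp only: o_apply)
      qed
    qed
  qed
qed

end
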